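(* Let $\overline{P}_1$ and $\overline{P}_2$ be two Preparata codes of the same length $n$. Then the minimal distance graphs of $\overline{P}_1$ and $\overline{P}_2$ are isomorphic if and only if $\overline{P}_1$ and $\overline{P}_2$ are isometric, i.e. there exists a map $I:\overline{P}_1\to\overline{P}_2$ with $d(I(x),I(y))=d(x,y)$ for all $x,y\in\overline{P}_1$.
   Context: $E^n$ is the set of binary vectors of length $n$ with the Hamming distance $d$. A Preparata code is a binary code of length $n=2^m$ ($m\ge 4$ even) with minimum distance (code distance) $6$ and maximum possible cardinality among binary codes of that length and minimum distance. The minimal distance graph of a code $C$ with code distance $d_C$ has the codewords of $C$ as vertices, two vertices being adjacent iff their Hamming distance equals $d_C$. *)

theory Defs
  imports Main
begin

definition bin_vectors :: "nat \<Rightarrow> bool list set" where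
  "bin_vectors n = {x. length x = n}"

definition hamming :: "bool list \<Rightarrow> bool list \<Rightarrow> nat" where
  "hamming x y = card {i. i < length x \<and> x ! i \<noteq> y ! i}"

definition min_dist :: "bool list set \<Rightarrow> nat" where
  "min_dist C = Min {hamming x y | x y. x \<in> C \<and> y \<in> C \<and> x \<noteq> y}"

definition dist_at_least :: "bool list set \<Rightarrow> nat \<Rightarrow> bool" where
  "dist_at_least C d \<longleftrightarrow> (\<forall>x\<in>C. \<forall>y\<in>C. x \<noteq> y \<longrightarrow> d \<le> hamming x y)"

definition preparata_code :: "nat \<Rightarrow> bool list set \<Rightarrow> bool" where
  "preparata_code n C \<longleftrightarrow>
     (\<exists>m. even m \<and> 4 \<le> m \<and> n = 2 ^ m) \<and>
     C \<subseteq> bin_vectors n \<and> min_dist C = 6 \<and>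
     (\<forall>D. D \<subseteq> bin_vectors n \<and> dist_at_least D 6 \<longrightarrow> card D \<le> card C)"

definition md_adj :: "bool list set \<Rightarrow> bool list \<Rightarrow> bool list \<Rightarrow> bool" where
  "md_adj C x y \<longleftrightarrow> x \<in> C \<and> y \<in> C \<and> hamming x y = min_dist C"

definition md_graphs_isomorphic :: "bool list set \<Rightarrow> bool list set \<Rightarrow> bool" where
  "md_graphs_isomorphic C1 C2 \<longleftrightarrow>
     (\<exists>f. bij_betw f C1 C2 \<and>
          (\<forall>x\<in>C1. \<forall>y\<in>C1. md_adj C1 x y \<longleftrightarrow> md_adj C2 (f x) (f y)))"

definition isometric :: "bool list set \<Rightarrow> bool list set \<Rightarrow> bool" where
  "isometric C1 C2 \<longleftrightarrow>
     (\<exists>I. I ` C1 \<subseteq> C2 \<and> (\<forall>x\<in>C1. \<forall>y\<in>C1. hamming (I x) (I y) = hamming x y))"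

end

theory Submission
  imports Defs "HOL-Algebra.Algebraic_Closure_Type" "HOL-Library.Z2"
begin

text \<open>
  Regard binary vectors as subsets of an \<open>n\<close>-set. A weighted count of the codewords at distance at
  most 4 from a vector bounds the size of a code with minimum distance 6 by \<open>2\<^sup>n / n\<^sup>2\<close>, and the
  construction of Baker, van Lint and Wilson shows that a Preparata code attains this bound.
  Equality forces the following: for every codeword \<open>x\<close> and every triple \<open>t\<close>, all points
  outside \<open>t\<close> but one lie in a set \<open>B \<supseteq> t\<close> of size 6 such that \<open>x + B\<close> is a codeword.

  Suppose now that an isomorphism of the minimal distance graphs preserves all distances below
  \<open>w > 6\<close> and sends codewords \<open>x\<close>, \<open>y\<close> at distance \<open>w\<close> to codewords at a larger distance
  \<open>w + e\<close>. A neighbour \<open>x + B\<close> of \<open>x\<close> with \<open>|B \<inter> (x + y)| = i \<ge> 4\<close> is closer than \<open>w\<close> to \<open>y\<close>, so its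
  image is a neighbour of the image of \<open>x\<close> with intersection number \<open>i + e / 2\<close>. Counting the
  4-subsets of \<open>x + y\<close> that are covered by such sets \<open>B\<close> gives a lower bound at \<open>(x, y)\<close> which
  contradicts the trivial upper bound at the images.
\<close>

section \<open>Symmetric differences and binomial coefficients\<close>

lemma card_Int_add_card_sym_diff:
  assumes "finite A" "finite B"
  shows "card (sym_diff A B) + 2 * card (A \<inter> B) = card A + card B"
proof -
  have "card A = card (A - B) + card (A \<inter> B)" "card B = card (B - A) + card (A \<inter> B)"
    using assms by (metis add.commute card_Int_Diff Int_commute)+
  moreover have "card (sym_diff A B) = card (A - B) + card (B - A)"
    using assms by (subst card_Un_disjoint) auto
  ultimately show ?thesis by simp
qed

lemma even_card_sym_diff:
  assumes "finite A" "finite B"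
  shows "even (card (sym_diff A B)) \<longleftrightarrow> even (card A + card B)"
  using card_Int_add_card_sym_diff[OF assms] by (metis dvd_triv_left even_add)

lemma sym_diff_inverse: "sym_diff (sym_diff A B) B = A"
  by auto

section \<open>Codes as families of sets with the symmetric difference distance\<close>

definition sdist :: "'a set \<Rightarrow> 'a set \<Rightarrow> nat" where
  "sdist A B = card (sym_diff A B)"

definition code6 :: "'a set set \<Rightarrow> bool" where
  "code6 C \<longleftrightarrow> (\<forall>x\<in>C. \<forall>y\<in>C. x \<noteq> y \<longrightarrow> 6 \<le> sdist x y)"

lemma sdist_translate: "sdist (sym_diff v A) (sym_diff v B) = sdist A B"
  unfolding sdist_def by (rule arg_cong[of _ _ card]) auto

lemma sdist_eq_0_iff: "finite A \<Longrightarrow> finite B \<Longrightarrow> sdist A B = 0 \<longleftrightarrow> A = B"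
  by (auto simp: sdist_def)

lemma sdist_add_twice_card_Int:
  "finite A \<Longrightarrow> finite B \<Longrightarrow> sdist A B + 2 * card (A \<inter> B) = card A + card B"
  by (simp add: sdist_def card_Int_add_card_sym_diff)

section \<open>Binomial coefficients as integer polynomials\<close>

lemma int_choose_Suc:
  "int (Suc k) * int (n choose Suc k) = int (n choose k) * (int n - int k)"
proof (cases "k \<le> n")
  case True
  have "Suc k * (n choose Suc k) = (n choose k) * (n - k)"
    using binomial_absorb_comp[of n k] times_binomial_minus1_eq[of "Suc k" n]
    by (simp add: mult.commute)
  hence "int (Suc k * (n choose Suc k)) = int ((n choose k) * (n - k))" by simp
  thus ?thesis using True by (simp only: of_nat_mult of_nat_diff)
qed (simp add: binomial_eq_0)

lemma int_choose_two: "2 * int (n choose 2) = int n * (int n - 1)"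
  using int_choose_Suc[of 1 n] by (simp flip: numeral_2_eq_2)

lemma int_choose_three: "6 * int (n choose 3) = int n * (int n - 1) * (int n - 2)"
proof -
  have "6 * int (n choose 3) = 2 * int (n choose 2) * (int n - 2)"
    using int_choose_Suc[of 2 n] by (simp flip: numeral_3_eq_3)
  thus ?thesis by (simp only: int_choose_two)
qed

lemma int_choose_four: "24 * int (n choose 4) = int n * (int n - 1) * (int n - 2) * (int n - 3)"
proof -
  have "24 * int (n choose 4) = 6 * int (n choose 3) * (int n - 3)"
    using int_choose_Suc[of 3 n] by simp
  thus ?thesis by (simp only: int_choose_three)
qed

text \<open>The members of \<open>S\<close> through a fixed point become disjoint triples once the
  point is removed, so there are at most \<open>(card G - 1) div 3\<close> of them; counting
  incidences gives the bound. The integer division is kept because its rounding is needed when a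
  codeword lies at distance 2.\<close>

lemma card_pair_packing:
  fixes S :: "'a set set"
  assumes "finite G" "\<And>B. B \<in> S \<Longrightarrow> B \<subseteq> G \<and> card B = 4"
    and "\<And>A B. A \<in> S \<Longrightarrow> B \<in> S \<Longrightarrow> A \<noteq> B \<Longrightarrow> card (A \<inter> B) \<le> 1"
  shows "4 * card S \<le> card G * ((card G - 1) div 3)"
proof -
  have fS: "finite S" using assms(1,2) by (meson finite_Pow_iff finite_subset PowI subsetI)
  have fB: "finite B" if "B \<in> S" for B using assms(1,2) that finite_subset by blast
  have pt: "card {B \<in> S. x \<in> B} \<le> (card G - 1) div 3" if "x \<in> G" for x
  proof -
    let ?T = "{B \<in> S. x \<in> B}"
    have "card (\<Union>B\<in>?T. B - {x}) = (\<Sum>B\<in>?T. card (B - {x}))"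
    proof (rule card_UN_disjoint)
      show "finite ?T" using fS by simp
      show "\<forall>i\<in>?T. finite (i - {x})" using fB by blast
      show "\<forall>A\<in>?T. \<forall>B\<in>?T. A \<noteq> B \<longrightarrow> (A - {x}) \<inter> (B - {x}) = {}"
      proof (intro ballI impI, rule ccontr)
        fix A B assume *: "A \<in> ?T" "B \<in> ?T" "A \<noteq> B" "(A - {x}) \<inter> (B - {x}) \<noteq> {}"
        then obtain y where "y \<in> A" "y \<in> B" "y \<noteq> x" by auto
        hence "{x, y} \<subseteq> A \<inter> B" "card {x, y} = 2" using * by auto
        hence "2 \<le> card (A \<inter> B)" using fB * by (metis (lifting) card_mono finite_Int mem_Collect_eq)
        thus False using assms(3)[of A B] * by simp
      qed
    qed
    also have "\<dots> = (\<Sum>B\<in>?T. 3)" using assms(2) fB by (intro sum.cong) auto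
    finally have "3 * card ?T = card (\<Union>B\<in>?T. B - {x})" by simp
    also have "\<dots> \<le> card (G - {x})" using assms(1,2) by (intro card_mono) auto
    also have "\<dots> = card G - 1" using that assms(1) by simp
    finally show ?thesis by simp
  qed
  have "(\<Sum>x\<in>G. card {B \<in> S. x \<in> B}) = (\<Sum>B\<in>S. card {x \<in> G. x \<in> B})"
    using assms(1) fS by (intro sum_multicount_gen) auto
  also have "\<dots> = (\<Sum>B\<in>S. 4)"
  proof (intro sum.cong refl)
    fix B assume "B \<in> S"
    hence "{x \<in> G. x \<in> B} = B" using assms(2) by auto
    thus "card {x \<in> G. x \<in> B} = 4" using assms(2) \<open>B \<in> S\<close> by simp
  qed
  finally have "4 * card S = (\<Sum>x\<in>G. card {B \<in> S. x \<in> B})" by simp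
  also have "\<dots> \<le> (\<Sum>x\<in>G. (card G - 1) div 3)" by (intro sum_mono pt)
  finally show ?thesis by simp
qed

section \<open>Equality in the Johnson bound\<close>

text \<open>Codewords around \<open>v\<close> are recorded by their differences from
  \<open>v\<close>, so that distances between them turn into sizes of intersections.\<close>

definition displacements :: "'a set set \<Rightarrow> 'a set \<Rightarrow> nat \<Rightarrow> 'a set set" where
  "displacements C v k = {B. sym_diff v B \<in> C \<and> card B = k}"

lemma displacements_subset:
  assumes "C \<subseteq> Pow G" "v \<subseteq> G" "B \<in> displacements C v k"
  shows "B \<subseteq> G" "card B = k"
proof -
  have "sym_diff v B \<subseteq> G" using assms by (auto simp: displacements_def)
  thus "B \<subseteq> G" using assms(2) by auto
qed (use assms in \<open>simp add: displacements_def\<close>)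

lemma finite_displacements:
  assumes "finite G" "C \<subseteq> Pow G" "v \<subseteq> G"
  shows "finite (displacements C v k)"
  using displacements_subset[OF assms(2,3)] assms(1) by (meson finite_Pow_iff finite_subset PowI subsetI)

text \<open>Translation by \<open>v\<close> preserves distances, so \<open>A\<close> and
  \<open>B\<close> are themselves at distance at least 6. Hence sets of sizes 3 and 3, or 3 and 4,
  are disjoint, two of size 4 share at most one point, and two of size 6 at most three.\<close>

lemma displacements_Int:
  assumes "finite G" "C \<subseteq> Pow G" "v \<subseteq> G" "code6 C"
    and "A \<in> displacements C v i" "B \<in> displacements C v j" "A \<noteq> B"
  shows "6 + 2 * card (A \<inter> B) \<le> i + j"
proof -
  have fin: "finite A" "finite B"
    using displacements_subset[OF assms(2,3)] assms(1,5,6) finite_subset by blast+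
  have "sym_diff v A \<noteq> sym_diff v B"
    using \<open>A \<noteq> B\<close> by blast
  hence "6 \<le> sdist (sym_diff v A) (sym_diff v B)"
    using assms(4-6) by (auto simp: code6_def displacements_def)
  hence "6 \<le> sdist A B" by (simp only: sdist_translate)
  thus ?thesis using sdist_add_twice_card_Int[OF fin] assms(5,6) by (simp add: displacements_def)
qed

text \<open>Double counting of pairs of a vector and a codeword at distance
  \<open>k\<close>.\<close>

lemma sum_card_displacements:
  assumes "finite G" "C \<subseteq> Pow G"
  shows "(\<Sum>v\<in>Pow G. card (displacements C v k)) = card C * (card G choose k)"
proof -
  have fC: "finite C" using assms finite_subset by (metis finite_Pow_iff)
  have "card (displacements C v k) = card {c \<in> C. sdist v c = k}" if "v \<in> Pow G" for v
  proof (rule bij_betw_same_card[of "sym_diff v"], rule bij_betw_byWitness[where f' = "sym_diff v"])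
    show "sym_diff v ` displacements C v k \<subseteq> {c \<in> C. sdist v c = k}"
    proof
      fix c assume "c \<in> sym_diff v ` displacements C v k"
      then obtain B where B: "c = sym_diff v B" "sym_diff v B \<in> C" "card B = k"
        by (auto simp: displacements_def)
      moreover have "sym_diff v c = B" unfolding B(1) by auto
      ultimately show "c \<in> {c \<in> C. sdist v c = k}" by (simp add: sdist_def)
    qed
    show "sym_diff v ` {c \<in> C. sdist v c = k} \<subseteq> displacements C v k"
    proof
      fix B assume "B \<in> sym_diff v ` {c \<in> C. sdist v c = k}"
      then obtain c where c: "B = sym_diff v c" "c \<in> C" "card (sym_diff v c) = k"
        by (auto simp: sdist_def)
      moreover have "sym_diff v B = c" unfolding c(1) by auto
      ultimately show "B \<in> displacements C v k" by (simp add: displacements_def)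
    qed
  qed auto
  hence "(\<Sum>v\<in>Pow G. card (displacements C v k)) = (\<Sum>v\<in>Pow G. card {c \<in> C. sdist v c = k})"
    by simp
  also have "\<dots> = (\<Sum>c\<in>C. card {v \<in> Pow G. sdist v c = k})"
    using assms(1) fC by (intro sum_multicount_gen) auto
  also have "\<dots> = (\<Sum>c\<in>C. card G choose k)"
  proof (intro sum.cong refl)
    fix c assume "c \<in> C"
    hence "c \<subseteq> G" using assms by auto
    have "card {v \<in> Pow G. sdist v c = k} = card {B. B \<subseteq> G \<and> card B = k}"
    proof (rule bij_betw_same_card[of "\<lambda>v. sym_diff v c"],
        rule bij_betw_byWitness[where f' = "\<lambda>v. sym_diff v c"])
      show "(\<lambda>v. sym_diff v c) ` {v \<in> Pow G. sdist v c = k} \<subseteq> {B. B \<subseteq> G \<and> card B = k}"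
        using \<open>c \<subseteq> G\<close> by (auto simp: sdist_def)
      show "(\<lambda>v. sym_diff v c) ` {B. B \<subseteq> G \<and> card B = k} \<subseteq> {v \<in> Pow G. sdist v c = k}"
        using \<open>c \<subseteq> G\<close> by (clarsimp simp only: sdist_def sym_diff_inverse) auto
    qed auto
    thus "card {v \<in> Pow G. sdist v c = k} = card G choose k"
      using n_subsets[OF assms(1), of k] by simp
  qed
  finally show ?thesis by simp
qed

text \<open>The coefficients arise by summing, over all coordinates, the Johnson inequality for the code
  punctured at that coordinate.\<close>
definition johnson_weight :: "'a set \<Rightarrow> 'a set set \<Rightarrow> 'a set \<Rightarrow> int" where
  "johnson_weight G C v = (let n = int (card G); a = (\<lambda>k. int (card (displacements C v k))) in
     n * (n - 1) * (a 0 + a 1) + (5 * n - 8) * a 2 + 3 * n * a 3 + 12 * a 4)"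

text \<open>The weights make the combination of the numbers \<open>card G choose k\<close> collapse
  to \<open>n ^ 2\<close> times \<open>n * (n - 1)\<close>, and the latter is the pointwise maximum
  of the weight. A code attaining that maximum everywhere thus has \<open>2 ^ n / n ^ 2\<close>
  words.\<close>

lemma sum_johnson_weight:
  assumes "finite G" "C \<subseteq> Pow G"
  shows "(\<Sum>v\<in>Pow G. johnson_weight G C v)
    = int (card C) * int (card G) ^ 2 * (int (card G) * (int (card G) - 1))"
proof -
  define n where "n = int (card G)"
  have S: "(\<Sum>v\<in>Pow G. int (card (displacements C v k))) = int (card C) * int (card G choose k)" for k
    using sum_card_displacements[OF assms, of k] by (simp flip: of_nat_sum of_nat_mult)
  have "(\<Sum>v\<in>Pow G. johnson_weight G C v) = int (card C) * (n * (n - 1) * (1 + n)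
      + (5 * n - 8) * int (card G choose 2) + 3 * n * int (card G choose 3) + 12 * int (card G choose 4))"
    unfolding johnson_weight_def Let_def
    by (simp only: sum.distrib sum_distrib_left[symmetric] S n_def[symmetric])
      (simp add: n_def algebra_simps)
  also have "n * (n - 1) * (1 + n) + (5 * n - 8) * int (card G choose 2)
      + 3 * n * int (card G choose 3) + 12 * int (card G choose 4) = n ^ 2 * (n * (n - 1))"
  proof -
    have "2 * (n * (n - 1) * (1 + n) + (5 * n - 8) * int (card G choose 2)
      + 3 * n * int (card G choose 3) + 12 * int (card G choose 4)) =
      2 * (n * (n - 1) * (1 + n)) + (5 * n - 8) * (2 * int (card G choose 2))
      + n * (6 * int (card G choose 3)) + 24 * int (card G choose 4)" by (simp add: algebra_simps)
    also have "\<dots> = 2 * (n ^ 2 * (n * (n - 1)))"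
      unfolding int_choose_two int_choose_three int_choose_four n_def[symmetric]
      by (simp add: algebra_simps power2_eq_square)
    finally show ?thesis by simp
  qed
  finally show ?thesis by (simp add: n_def)
qed

text \<open>The codeword nearest to \<open>v\<close> decides. One within distance 1 excludes all
  others up to distance 4; one at distance 2 leaves only 4-sets packed outside it; otherwise the
  3-sets are disjoint and the 4-sets are packed into the points they miss. With \<open>a\<close>
  sets of size 3, the last case loses at least \<open>9 * a * (l - a)\<close>, so equality forces
  \<open>a = 0\<close> or \<open>a = l\<close>.\<close>

lemma johnson_weight_le:
  assumes G: "finite G" "card G = 3 * l + 1" "l > 0" and C: "C \<subseteq> Pow G" "code6 C" and v: "v \<subseteq> G"
  shows "johnson_weight G C v \<le> int (card G) * (int (card G) - 1)"
    and "displacements C v 3 \<noteq> {} \<Longrightarrow> johnson_weight G C v = int (card G) * (int (card G) - 1)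
           \<Longrightarrow> card (displacements C v 3) = l"
proof -
  let ?S = "displacements C v"
  note sub = displacements_subset[OF C(1) v]
  note meet = displacements_Int[OF G(1) C(1) v C(2)]
  note fin = finite_displacements[OF G(1) C(1) v]
  have fB: "finite B" if "B \<in> ?S k" for B k using sub[OF that] G(1) finite_subset by blast
  have low: "?S j = (if j = i then {A} else {})" if "A \<in> ?S i" "i + j < 6" for A i j
  proof -
    have "?S j \<subseteq> {A}" using meet[OF that(1)] that(2) by fastforce
    moreover have "A \<notin> ?S j" if "j \<noteq> i" using that \<open>A \<in> ?S i\<close> by (simp add: displacements_def)
    ultimately have "?S j = {}" if "j \<noteq> i" using that by blast
    moreover have "?S j = {A}" if "j = i" using that \<open>?S j \<subseteq> {A}\<close> \<open>A \<in> ?S i\<close> by blast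
    ultimately show ?thesis by simp
  qed
  have pack: "4 * card (?S 4) \<le> card (G - U) * ((card (G - U) - 1) div 3)"
    if "\<And>B. B \<in> ?S 4 \<Longrightarrow> B \<inter> U = {}" for U
  proof (rule card_pair_packing)
    show "card (A \<inter> B) \<le> 1" if "A \<in> ?S 4" "B \<in> ?S 4" "A \<noteq> B" for A B
      using meet[OF that] by simp
    show "finite (G - U)" using G(1) by simp
    show "B \<subseteq> G - U \<and> card B = 4" if "B \<in> ?S 4" for B
      using sub[OF that] \<open>\<And>B. B \<in> ?S 4 \<Longrightarrow> B \<inter> U = {}\<close>[OF that] by blast
  qed
  consider (a) A i where "i \<le> 1" "A \<in> ?S i" | (b) A where "A \<in> ?S 2"
    | (c) "?S 0 = {}" "?S 1 = {}" "?S 2 = {}"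
    by (metis equals0I le_refl zero_le_one)
  hence "johnson_weight G C v \<le> int (card G) * (int (card G) - 1) \<and>
    (?S 3 \<noteq> {} \<longrightarrow> johnson_weight G C v = int (card G) * (int (card G) - 1) \<longrightarrow> card (?S 3) = l)"
  proof cases
    case a
    have "?S j = (if j = i then {A} else {})" if "j \<le> 4" for j
      using low[OF a(2)] a(1) that by simp
    thus ?thesis using a(1) by (auto simp: johnson_weight_def Let_def)
  next
    case b
    have e: "?S 0 = {}" "?S 1 = {}" "?S 2 = {A}" "?S 3 = {}"
      using low[OF b] by auto
    have "B \<inter> A = {}" if "B \<in> ?S 4" for B
    proof -
      have "B \<noteq> A" using that b by (auto simp: displacements_def)
      hence "card (B \<inter> A) = 0" using meet[OF that b] by simp
      thus ?thesis using fB[OF b] by simp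
    qed
    hence "4 * card (?S 4) \<le> card (G - A) * ((card (G - A) - 1) div 3)" by (rule pack)
    \<comment> \<open>With \<open>l = r + 1\<close> the complement of \<open>A\<close> has
      \<open>3 * r + 2\<close> points, and the integer division drops a remainder of 1.\<close>
    moreover obtain r where r: "l = Suc r" using G(3) gr0_implies_Suc by blast
    moreover have "card (G - A) = 3 * r + 2"
      using sub[OF b] G fB[OF b] r by (simp add: card_Diff_subset)
    moreover have "(3 * r + 2 - 1) div 3 = r" by simp
    ultimately have "4 * card (?S 4) \<le> (3 * r + 2) * r" by metis
    hence "int (4 * card (?S 4)) \<le> int ((3 * r + 2) * r)" by (rule of_nat_mono)
    hence "12 * int (card (?S 4)) \<le> 3 * ((3 * int r + 2) * int r)" by (simp add: algebra_simps)
    thus ?thesis unfolding johnson_weight_def Let_def e G(2) r by (simp add: algebra_simps)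
  next
    case c
    define U where "U = \<Union> (?S 3)"
    have dis: "A \<inter> B = {}" if "A \<in> ?S 3" "B \<in> ?S 3" "A \<noteq> B" for A B
      using meet[OF that] fB[OF that(1)] by simp
    have "card U = sum card (?S 3)" unfolding U_def
      by (rule card_Union_disjoint) (use dis fB in \<open>auto simp: pairwise_def disjnt_def\<close>)
    also have "\<dots> = sum (\<lambda>_. 3) (?S 3)" using sub by (intro sum.cong) auto
    finally have cU: "card U = 3 * card (?S 3)" by simp
    have UG: "U \<subseteq> G" using sub by (auto simp: U_def)
    hence "card U \<le> card G" using G(1) by (simp add: card_mono)
    hence le: "card (?S 3) \<le> l" using cU G(2) by simp
    have "B \<inter> U = {}" if "B \<in> ?S 4" for B
    proof -
      have "B \<inter> A = {}" if A: "A \<in> ?S 3" for A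
      proof -
        have "B \<noteq> A" using that \<open>B \<in> ?S 4\<close> by (auto simp: displacements_def)
        hence "card (B \<inter> A) = 0" using meet[OF \<open>B \<in> ?S 4\<close> A] by simp
        thus ?thesis using fB[OF A] by simp
      qed
      thus ?thesis by (auto simp: U_def)
    qed
    hence "4 * card (?S 4) \<le> card (G - U) * ((card (G - U) - 1) div 3)" by (rule pack)
    moreover obtain r where r: "l = card (?S 3) + r" using le le_Suc_ex by blast
    moreover have "card (G - U) = 3 * r + 1"
      using UG G(1,2) cU r by (simp add: card_Diff_subset finite_subset)
    ultimately have "4 * card (?S 4) \<le> (3 * r + 1) * r" by simp
    hence "int (4 * card (?S 4)) \<le> int ((3 * r + 1) * r)" by (rule of_nat_mono)
    hence "4 * int (card (?S 4)) \<le> (3 * int r + 1) * int r" by (simp add: algebra_simps)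
    moreover define a where "a = int (card (?S 3))"
    ultimately have main: "johnson_weight G C v + 9 * (a * int r) \<le> int (card G) * (int (card G) - 1)"
      unfolding johnson_weight_def Let_def c G(2) by (simp add: r a_def algebra_simps)
    have "a * int r \<ge> 0" by (simp add: a_def)
    moreover have "card (?S 3) = l"
      if "?S 3 \<noteq> {}" "johnson_weight G C v = int (card G) * (int (card G) - 1)"
    proof -
      have "a * int r \<le> 0" using main that(2) by linarith
      moreover have "a > 0" using that(1) fin by (simp add: a_def card_gt_0_iff)
      ultimately have "r = 0" by (simp add: mult_le_0_iff)
      thus ?thesis using r by simp
    qed
    ultimately show ?thesis using main by force
  qed
  thus "johnson_weight G C v \<le> int (card G) * (int (card G) - 1)"
    and "?S 3 \<noteq> {} \<Longrightarrow> johnson_weight G C v = int (card G) * (int (card G) - 1) \<Longrightarrow> card (?S 3) = l"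
    by auto
qed

text \<open>For a code of this size the total Johnson weight reaches the sum of the pointwise
  bounds, so every single vector attains its bound.\<close>

lemma card_displacements_three:
  assumes G: "finite G" "card G = 3 * l + 1" "l > 0" and C: "C \<subseteq> Pow G" "code6 C"
    and large: "2 ^ card G \<le> card C * card G ^ 2"
    and v: "v \<subseteq> G" "displacements C v 3 \<noteq> {}"
  shows "card (displacements C v 3) = l"
proof -
  let ?m = "int (card G) * (int (card G) - 1)"
  have "(\<Sum>v\<in>Pow G. ?m) = 2 ^ card G * ?m" using G(1) by (simp add: card_Pow)
  also have "\<dots> \<le> int (card C * card G ^ 2) * ?m"
    using large by (intro mult_right_mono) (use G(2) in \<open>simp_all flip: of_nat_le_iff[where 'a=int]\<close>)
  also have "\<dots> = (\<Sum>v\<in>Pow G. johnson_weight G C v)"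
    using sum_johnson_weight[OF G(1) C(1)] by simp
  finally have "sum (johnson_weight G C) (Pow G) = sum (\<lambda>_. ?m) (Pow G)"
    using sum_mono[of "Pow G" "johnson_weight G C" "\<lambda>_. ?m"] johnson_weight_le(1)[OF G C] by force
  hence "johnson_weight G C v = ?m"
    by (rule sum_mono_inv) (use johnson_weight_le(1)[OF G C] G(1) v in auto)
  thus ?thesis using johnson_weight_le(2)[OF G C v] by simp
qed

section \<open>Codewords at distance six\<close>

abbreviation blocks :: "'a set set \<Rightarrow> 'a set \<Rightarrow> 'a set set" where
  "blocks C x \<equiv> displacements C x 6"

text \<open>Equivalently, this counts the neighbours of \<open>x\<close> at distance
  \<open>sdist x y + 6 - 2 * i\<close> from \<open>y\<close>; this links it to maps that preserve
  distances.\<close>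

definition block_count :: "'a set set \<Rightarrow> 'a set \<Rightarrow> 'a set \<Rightarrow> nat \<Rightarrow> nat" where
  "block_count C x y i = card {B \<in> blocks C x. card (B \<inter> sym_diff x y) = i}"

text \<open>A block has at most 6 points in \<open>sym_diff x y\<close>, and
  \<open>i choose 4\<close> is 1, 5, 15 for \<open>i\<close> equal to 4, 5, 6 and zero
  below.\<close>

lemma sum_covered_four_subsets:
  assumes "finite G" "C \<subseteq> Pow G" "x \<subseteq> G" "y \<subseteq> G"
  shows "(\<Sum>B\<in>blocks C x. card (B \<inter> sym_diff x y) choose 4)
    = block_count C x y 4 + 5 * block_count C x y 5 + 15 * block_count C x y 6"
proof -
  let ?D = "sym_diff x y" and ?S = "blocks C x"
  have fS: "finite ?S" by (rule finite_displacements[OF assms(1-3)])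
  have fB: "finite B" if "B \<in> ?S" for B
    using that card.infinite by (force simp: displacements_def)
  have c: "card (B \<inter> ?D) choose 4 = (if card (B \<inter> ?D) = 4 then 1 else 0)
      + (if card (B \<inter> ?D) = 5 then 5 else 0) + (if card (B \<inter> ?D) = 6 then 15 else 0)"
    if "B \<in> ?S" for B
  proof -
    have "card (B \<inter> ?D) \<le> card B" using fB[OF that] by (intro card_mono) auto
    hence "card (B \<inter> ?D) \<le> 6" using that by (simp add: displacements_def)
    then consider "card (B \<inter> ?D) < 4" | "card (B \<inter> ?D) = 4" | "card (B \<inter> ?D) = 5" | "card (B \<inter> ?D) = 6"
      by linarith
    moreover have "(5::nat) choose 4 = 5" "(6::nat) choose 4 = 15" by (simp_all add: numeral_eq_Suc)
    ultimately show ?thesis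
    proof cases
      case 1 thus ?thesis by (simp add: binomial_eq_0)
    qed simp_all
  qed
  have i: "(\<Sum>B\<in>?S. if card (B \<inter> ?D) = i then k else 0) = k * block_count C x y i" for i k
    using fS by (simp add: sum.If_cases block_count_def Int_def)
  show ?thesis
    by (simp only: sum.cong[OF refl c] sum.distrib i mult_1)
qed

text \<open>Two blocks share at most three points, so no 4-subset of \<open>sym_diff x y\<close> is
  counted twice.\<close>

lemma covered_four_subsets_upper:
  assumes "finite G" "C \<subseteq> Pow G" "code6 C" "x \<subseteq> G" "y \<subseteq> G"
  shows "block_count C x y 4 + 5 * block_count C x y 5 + 15 * block_count C x y 6 \<le> sdist x y choose 4"
proof -
  let ?D = "sym_diff x y" and ?S = "blocks C x"
  have fD: "finite ?D" using assms finite_subset by blast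
  have fS: "finite ?S" by (rule finite_displacements[OF assms(1,2,4)])
  let ?Q = "\<lambda>B. {u. u \<subseteq> B \<inter> ?D \<and> card u = 4}"
  have "(\<Sum>B\<in>?S. card (B \<inter> ?D) choose 4) = (\<Sum>B\<in>?S. card (?Q B))"
    using fD by (intro sum.cong refl n_subsets[symmetric]) auto
  also have "\<dots> = card (\<Union>B\<in>?S. ?Q B)"
  proof (rule card_UN_disjoint[symmetric])
    show "\<forall>B\<in>?S. finite (?Q B)" using fD by (auto intro!: finite_subset[of _ "Pow ?D"])
    show "\<forall>A\<in>?S. \<forall>B\<in>?S. A \<noteq> B \<longrightarrow> ?Q A \<inter> ?Q B = {}"
    proof (intro ballI impI, rule ccontr)
      fix A B assume *: "A \<in> ?S" "B \<in> ?S" "A \<noteq> B" "?Q A \<inter> ?Q B \<noteq> {}"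
      then obtain u where u: "u \<subseteq> A \<inter> B" "card u = 4" by auto
      have "finite A" using *(1) card.infinite by (force simp: displacements_def)
      hence "4 \<le> card (A \<inter> B)" using card_mono[OF _ u(1)] u(2) by simp
      thus False using displacements_Int[OF assms(1,2,4,3)] * by fastforce
    qed
  qed (rule fS)
  also have "\<dots> \<le> card {u. u \<subseteq> ?D \<and> card u = 4}"
    using fD by (intro card_mono) (auto intro!: finite_subset[of _ "Pow ?D"])
  also have "\<dots> = sdist x y choose 4" using n_subsets[OF fD] by (simp add: sdist_def)
  finally show ?thesis using sum_covered_four_subsets[OF assms(1,2,4,5)] by simp
qed

text \<open>Around the vector \<open>v\<close> obtained from \<open>x\<close> by flipping
  \<open>t\<close>, the \<open>l\<close> displacements of size 3 are disjoint and miss one point of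
  \<open>G\<close>. Each of them other than \<open>t\<close> joins \<open>t\<close> to form a block,
  so only the missed point can stay uncovered.\<close>

lemma uncovered_point_unique:
  assumes G: "finite G" "card G = 3 * l + 1" "l > 0" and C: "C \<subseteq> Pow G" "code6 C"
    and large: "2 ^ card G \<le> card C * card G ^ 2"
    and x: "x \<in> C" and t: "t \<subseteq> G" "card t = 3"
    and p: "p \<in> G - t" "\<not> (\<exists>B\<in>blocks C x. insert p t \<subseteq> B)"
    and p': "p' \<in> G - t" "\<not> (\<exists>B\<in>blocks C x. insert p' t \<subseteq> B)"
  shows "p = p'"
proof -
  have xG: "x \<subseteq> G" using x C by auto
  define v where "v = sym_diff x t"
  have v: "v \<subseteq> G" using xG t by (auto simp: v_def)
  have vt: "sym_diff v t = x" unfolding v_def by auto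
  let ?S = "displacements C v 3"
  have tS: "t \<in> ?S" using vt x t by (simp add: displacements_def)
  hence cS: "card ?S = l" using card_displacements_three[OF G C large v] by auto
  note sub = displacements_subset[OF C(1) v]
  have fB: "finite B" if "B \<in> ?S" for B using sub[OF that] G(1) finite_subset by blast
  have dis: "A \<inter> B = {}" if "A \<in> ?S" "B \<in> ?S" "A \<noteq> B" for A B
    using displacements_Int[OF G(1) C(1) v C(2) that] fB[OF that(1)] by simp
  have "card (\<Union> ?S) = sum card ?S"
    by (rule card_Union_disjoint) (use dis fB in \<open>auto simp: pairwise_def disjnt_def\<close>)
  also have "\<dots> = sum (\<lambda>_. 3) ?S" using sub by (intro sum.cong) auto
  finally have cU: "card (\<Union> ?S) = 3 * l" using cS by simp
  have UG: "\<Union> ?S \<subseteq> G" using sub by auto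
  hence "card (G - \<Union> ?S) = 1" using G cU by (simp add: card_Diff_subset finite_subset)
  moreover have "z \<in> G - \<Union> ?S"
    if z: "z \<in> G - t" "\<not> (\<exists>B\<in>blocks C x. insert z t \<subseteq> B)" for z
  proof (rule ccontr)
    assume "z \<notin> G - \<Union> ?S"
    then obtain s where s: "s \<in> ?S" "z \<in> s" using z by auto
    hence st: "t \<inter> s = {}" using dis[OF tS, of s] z by auto
    have "sym_diff x (t \<union> s) = sym_diff v s" using st unfolding v_def by auto
    moreover have "card (t \<union> s) = 6"
      using st fB[OF s(1)] fB[OF tS] sub[OF s(1)] t(2) by (simp add: card_Un_disjoint)
    ultimately have "t \<union> s \<in> blocks C x" using s by (simp add: displacements_def)
    thus False using z s by blast
  qed
  ultimately show ?thesis using p p' by (metis card_1_singletonE singletonD)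
qed

text \<open>By \<open>uncovered_point_unique\<close> a triple inside \<open>sym_diff x y\<close>
  extends to at most one uncovered 4-subset, and each such subset contains four triples. The
  binomial coefficient with 3 is the resulting allowance for uncovered 4-subsets.\<close>

lemma covered_four_subsets_lower:
  assumes G: "finite G" "card G = 3 * l + 1" "l > 0" and C: "C \<subseteq> Pow G" "code6 C"
    and large: "2 ^ card G \<le> card C * card G ^ 2"
    and x: "x \<in> C" and y: "y \<subseteq> G"
  shows "4 * (sdist x y choose 4) \<le> (sdist x y choose 3) +
    4 * (block_count C x y 4 + 5 * block_count C x y 5 + 15 * block_count C x y 6)"
proof -
  let ?D = "sym_diff x y" and ?S = "blocks C x"
  have xG: "x \<subseteq> G" using x C by auto
  have DG: "?D \<subseteq> G" using xG y by auto
  have fD: "finite ?D" using DG G finite_subset by blast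
  have fS: "finite ?S" by (rule finite_displacements[OF G(1) C(1) xG])
  have fP: "finite {u. u \<subseteq> ?D \<and> card u = k}" for k
    using fD by (auto intro!: finite_subset[of _ "Pow ?D"])
  define cov where "cov = (\<Union>B\<in>?S. {u. u \<subseteq> B \<inter> ?D \<and> card u = 4})"
  define unc where "unc = {u. u \<subseteq> ?D \<and> card u = 4} - cov"
  have "card cov \<le> (\<Sum>B\<in>?S. card {u. u \<subseteq> B \<inter> ?D \<and> card u = 4})"
    unfolding cov_def by (rule card_UN_le[OF fS])
  also have "\<dots> = (\<Sum>B\<in>?S. card (B \<inter> ?D) choose 4)"
    using fD by (intro sum.cong refl n_subsets) auto
  finally have ccov: "card cov \<le> block_count C x y 4 + 5 * block_count C x y 5 + 15 * block_count C x y 6"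
    using sum_covered_four_subsets[OF G(1) C(1) xG y] by simp
  have covsub: "cov \<subseteq> {u. u \<subseteq> ?D \<and> card u = 4}" by (auto simp: cov_def)
  have "card unc + card cov = card {u. u \<subseteq> ?D \<and> card u = 4}"
    unfolding unc_def using card_Diff_subset[OF finite_subset[OF covsub fP] covsub]
      card_mono[OF fP covsub] by simp
  also have "\<dots> = sdist x y choose 4" using n_subsets[OF fD] by (simp add: sdist_def)
  finally have split: "card unc + card cov = sdist x y choose 4" .
  let ?T = "{t. t \<subseteq> ?D \<and> card t = 3}"
  have fin_unc: "finite unc" using fP by (simp add: unc_def)
  have "(\<Sum>u\<in>unc. card {t \<in> ?T. t \<subseteq> u}) = (\<Sum>t\<in>?T. card {u \<in> unc. t \<subseteq> u})"
    using fP fin_unc by (intro sum_multicount_gen) auto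
  also have "\<dots> \<le> (\<Sum>t\<in>?T. 1)"
  proof (rule sum_mono)
    fix t assume t: "t \<in> ?T"
    have "u = u'" if "u \<in> unc" "t \<subseteq> u" "u' \<in> unc" "t \<subseteq> u'" for u u'
    proof -
      have ex: "\<exists>p. p \<in> G - t \<and> \<not> (\<exists>B\<in>?S. insert p t \<subseteq> B) \<and> u = insert p t"
        if "u \<in> unc" "t \<subseteq> u" for u
      proof -
        have u: "u \<subseteq> ?D" "card u = 4" "u \<notin> cov" using that by (auto simp: unc_def)
        have fu: "finite u" using u(1) fD finite_subset by blast
        have "card (u - t) = 1" using that(2) u(2) t fu by (simp add: card_Diff_subset finite_subset)
        then obtain p where "u - t = {p}" by (rule card_1_singletonE)
        hence "p \<in> G - t" "u = insert p t" using that(2) u(1) DG by auto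
        moreover have "\<not> (\<exists>B\<in>?S. u \<subseteq> B)" using u by (auto simp: cov_def)
        ultimately show ?thesis by auto
      qed
      obtain p where p: "p \<in> G - t" "\<not> (\<exists>B\<in>?S. insert p t \<subseteq> B)" "u = insert p t"
        using ex \<open>u \<in> unc\<close> \<open>t \<subseteq> u\<close> by blast
      obtain p' where p': "p' \<in> G - t" "\<not> (\<exists>B\<in>?S. insert p' t \<subseteq> B)" "u' = insert p' t"
        using ex \<open>u' \<in> unc\<close> \<open>t \<subseteq> u'\<close> by blast
      have "p = p'"
        using uncovered_point_unique[OF G C large x _ _ p(1,2) p'(1,2)] t DG by auto
      thus ?thesis using p p' by simp
    qed
    thus "card {u \<in> unc. t \<subseteq> u} \<le> 1"
      using fin_unc by (simp add: card_le_Suc0_iff_eq)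
  qed
  also have "\<dots> = sdist x y choose 3" using n_subsets[OF fD] by (simp add: sdist_def)
  also have "(\<Sum>u\<in>unc. card {t \<in> ?T. t \<subseteq> u}) = (\<Sum>u\<in>unc. 4)"
  proof (intro sum.cong refl)
    fix u assume "u \<in> unc"
    hence u: "u \<subseteq> ?D" "card u = 4" by (auto simp: unc_def)
    have "{t \<in> ?T. t \<subseteq> u} = {t. t \<subseteq> u \<and> card t = 3}" using u by auto
    moreover have "finite u" using u fD finite_subset by blast
    ultimately show "card {t \<in> ?T. t \<subseteq> u} = 4"
      using n_subsets[of u 3] u by (simp add: numeral_eq_Suc)
  qed
  finally have "4 * card unc \<le> sdist x y choose 3" by simp
  thus ?thesis using ccov split by simp
qed

section \<open>Comparison of distances in the two codes\<close>

lemma block_card_Int: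
  assumes "finite G" "C \<subseteq> Pow G" "x \<subseteq> G" "y \<subseteq> G" "B \<in> blocks C x"
  shows "sdist (sym_diff x B) y + 2 * card (B \<inter> sym_diff x y) = sdist x y + 6"
proof -
  have "B \<subseteq> G" using displacements_subset[OF assms(2,3)] assms(5) by simp
  hence "finite B" using assms(1) finite_subset by blast
  moreover have "finite (sym_diff x y)" using assms(1,3,4) finite_subset by blast
  moreover have "sdist (sym_diff x B) y = sdist B (sym_diff x y)"
    unfolding sdist_def by (rule arg_cong[of _ _ card]) auto
  ultimately show ?thesis using sdist_add_twice_card_Int[of B "sym_diff x y"] assms(5)
    by (simp add: displacements_def sdist_def)
qed

text \<open>An increase by \<open>e\<close> shifts intersection numbers by \<open>e / 2\<close>, and
  \<open>i choose 4\<close> grows so fast that the images of the blocks would cover more 4-subsets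
  than exist. As intersection numbers stop at 6, only \<open>e = 2\<close> and \<open>e = 4\<close>
  need a real estimate.\<close>

lemma distance_not_increased:
  fixes C C' :: "'a set set" and f :: "'a set \<Rightarrow> 'a set"
  assumes G: "finite G" "card G = 3 * l + 1" "l > 0"
    and C: "C \<subseteq> Pow G" "code6 C" and C': "C' \<subseteq> Pow G" "code6 C'"
    and large: "2 ^ card G \<le> card C * card G ^ 2"
    and f: "f ` C \<subseteq> C'" "inj_on f C"
    and x: "x \<in> C" and y: "y \<in> C"
    and pres: "\<And>u v. u \<in> C \<Longrightarrow> v \<in> C \<Longrightarrow> sdist u v < sdist x y \<Longrightarrow> sdist (f u) (f v) = sdist u v"
    and w: "6 < sdist x y"
  shows "sdist (f x) (f y) \<le> sdist x y"
proof (rule ccontr)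
  assume "\<not> ?thesis"
  then obtain e where e: "sdist (f x) (f y) = sdist x y + e" "e > 0"
    by (metis less_imp_add_positive not_le)
  define w where "w = sdist x y"
  let ?n = "block_count C x y" and ?n' = "block_count C' (f x) (f y)"
  have xy: "x \<subseteq> G" "y \<subseteq> G" "f x \<subseteq> G" "f y \<subseteq> G" using x y C(1) C'(1) f(1) by auto
  \<comment> \<open>For \<open>i \<ge> 4\<close> the neighbour \<open>z\<close> lies at distance
    \<open>w + 6 - 2 * i < w\<close> from \<open>y\<close>, so this distance is preserved, while
    that of \<open>x\<close> and \<open>y\<close> grows by \<open>e\<close>. The intersection number
    has to make up for the difference.\<close>
  have im: "sym_diff (f x) (f (sym_diff x B)) \<in> blocks C' (f x) \<and>
      2 * card (sym_diff (f x) (f (sym_diff x B)) \<inter> sym_diff (f x) (f y)) = 2 * card (B \<inter> sym_diff x y) + e"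
    if B: "B \<in> blocks C x" and i: "card (B \<inter> sym_diff x y) \<ge> 4" for B
  proof -
    define z where "z = sym_diff x B"
    define B' where "B' = sym_diff (f x) (f z)"
    have z: "z \<in> C" using B by (simp add: displacements_def z_def)
    have "sym_diff x z = B" by (auto simp: z_def)
    hence "sdist x z = 6" using B by (simp add: sdist_def displacements_def)
    hence "sdist (f x) (f z) = 6" using pres[OF x z] \<open>6 < sdist x y\<close> by simp
    moreover have fz: "sym_diff (f x) B' = f z" by (auto simp: B'_def)
    ultimately have B': "B' \<in> blocks C' (f x)"
      using z f(1) by (auto simp: displacements_def sdist_def B'_def[symmetric])
    have 1: "sdist z y + 2 * card (B \<inter> sym_diff x y) = w + 6"
      using block_card_Int[OF G(1) C(1) xy(1,2) B] by (simp add: z_def w_def)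
    hence "sdist (f z) (f y) = sdist z y" using pres[OF z y] i by (simp add: w_def)
    moreover have "sdist (f z) (f y) + 2 * card (B' \<inter> sym_diff (f x) (f y)) = w + e + 6"
      using block_card_Int[OF G(1) C'(1) xy(3,4) B'] e(1) by (simp only: fz w_def)
    ultimately show ?thesis using B' 1 unfolding B'_def z_def by simp
  qed
  have small: "card (B \<inter> D) \<le> 6" if "B \<in> blocks K u" for B D K and u :: "'a set"
  proof -
    have "card B = 6" using that by (simp add: displacements_def)
    moreover have "finite B" using calculation card.infinite by force
    ultimately show ?thesis using card_mono[of B "B \<inter> D"] by simp
  qed
  have fb: "finite (blocks C' (f x))"
    by (rule finite_displacements[OF G(1) C'(1) xy(3)])
  have le: "?n i \<le> ?n' j" if "i \<ge> 4" "2 * j = 2 * i + e" for i j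
    unfolding block_count_def
  proof (rule card_inj_on_le[where f = "\<lambda>B. sym_diff (f x) (f (sym_diff x B))"])
    show "inj_on (\<lambda>B. sym_diff (f x) (f (sym_diff x B))) {B \<in> blocks C x. card (B \<inter> sym_diff x y) = i}"
    proof (rule inj_onI)
      fix A B assume A: "A \<in> {B \<in> blocks C x. card (B \<inter> sym_diff x y) = i}"
        and B: "B \<in> {B \<in> blocks C x. card (B \<inter> sym_diff x y) = i}"
        and eq: "sym_diff (f x) (f (sym_diff x A)) = sym_diff (f x) (f (sym_diff x B))"
      from eq have "f (sym_diff x A) = f (sym_diff x B)" by blast
      hence "sym_diff x A = sym_diff x B" using f(2) A B by (auto simp: displacements_def dest: inj_onD)
      thus "A = B" by blast
    qed
    show "finite {B \<in> blocks C' (f x). card (B \<inter> sym_diff (f x) (f y)) = j}" using fb by simp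
    show "(\<lambda>B. sym_diff (f x) (f (sym_diff x B))) ` {B \<in> blocks C x. card (B \<inter> sym_diff x y) = i}
      \<subseteq> {B \<in> blocks C' (f x). card (B \<inter> sym_diff (f x) (f y)) = j}"
      using im that by fastforce
  qed
  \<comment> \<open>The shifted intersection number \<open>i + e / 2\<close> must be an integer not
    above 6.\<close>
  have zero: "?n i = 0" if "i \<ge> 4" "odd e \<or> 2 * i + e > 12" for i
  proof -
    have False if B: "B \<in> blocks C x" "card (B \<inter> sym_diff x y) = i" for B
    proof -
      let ?B = "sym_diff (f x) (f (sym_diff x B))"
      have 2: "?B \<in> blocks C' (f x)" "2 * card (?B \<inter> sym_diff (f x) (f y)) = 2 * i + e"
        using im[OF B(1)] B(2) \<open>i \<ge> 4\<close> by auto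
      have "even (2 * i + e)" using 2(2) by (metis dvd_triv_left)
      moreover have "2 * i + e \<le> 12" using 2(2) small[OF 2(1), of "sym_diff (f x) (f y)"] by linarith
      ultimately show False using \<open>odd e \<or> 2 * i + e > 12\<close> by simp
    qed
    hence "{B \<in> blocks C x. card (B \<inter> sym_diff x y) = i} = {}" by blast
    thus ?thesis by (simp only: block_count_def card.empty)
  qed
  \<comment> \<open>Such a block yields a codeword at distance \<open>w - 4\<close> from
    \<open>y\<close>, strictly between 0 and 6.\<close>
  have zero5: "?n 5 = 0" if "w < 10"
  proof -
    have False if B: "B \<in> blocks C x" "card (B \<inter> sym_diff x y) = 5" for B
    proof -
      have "sdist (sym_diff x B) y + 10 = w + 6"
        using block_card_Int[OF G(1) C(1) xy(1,2) B(1)] B(2) by (simp add: w_def)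
      hence "0 < sdist (sym_diff x B) y" "sdist (sym_diff x B) y < 6"
        using \<open>w < 10\<close> \<open>6 < sdist x y\<close> w_def by auto
      moreover have "sym_diff x B \<in> C" using B by (simp add: displacements_def)
      moreover have "sym_diff x B \<noteq> y" using calculation(1) by (auto simp: sdist_def)
      ultimately show False using C(2) y by (meson code6_def not_le)
    qed
    hence "{B \<in> blocks C x. card (B \<inter> sym_diff x y) = 5} = {}" by blast
    thus ?thesis by (simp only: block_count_def card.empty)
  qed
  define W where "W = int w"
  have W: "W \<ge> 7" using \<open>6 < sdist x y\<close> by (simp add: W_def w_def)
  \<comment> \<open>The left side is \<open>24 * (w choose 4) - 6 * (w choose 3)\<close>; the
    subtracted term turns the factor \<open>W - 3\<close> into \<open>W - 4\<close>.\<close>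
  have low: "W * (W - 1) * (W - 2) * (W - 4) \<le> 24 * (int (?n 4) + 5 * int (?n 5) + 15 * int (?n 6))"
  proof -
    have "4 * (w choose 4) \<le> (w choose 3) + 4 * (?n 4 + 5 * ?n 5 + 15 * ?n 6)"
      using covered_four_subsets_lower[OF G C large x xy(2)] by (simp add: w_def)
    hence "int (4 * (w choose 4)) \<le> int ((w choose 3) + 4 * (?n 4 + 5 * ?n 5 + 15 * ?n 6))"
      by (rule of_nat_mono)
    hence "24 * int (w choose 4) \<le> 6 * int (w choose 3) + 24 * (int (?n 4) + 5 * int (?n 5) + 15 * int (?n 6))"
      by simp
    thus ?thesis unfolding int_choose_three int_choose_four W_def[symmetric] by (simp add: algebra_simps)
  qed
  have up: "24 * (int (?n' 4) + 5 * int (?n' 5) + 15 * int (?n' 6))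
     \<le> (W + int e) * (W + int e - 1) * (W + int e - 2) * (W + int e - 3)"
  proof -
    have "?n' 4 + 5 * ?n' 5 + 15 * ?n' 6 \<le> (w + e) choose 4"
      using covered_four_subsets_upper[OF G(1) C' xy(3,4)] e(1) by (simp add: w_def)
    hence "int (?n' 4 + 5 * ?n' 5 + 15 * ?n' 6) \<le> int ((w + e) choose 4)" by (rule of_nat_mono)
    hence "24 * (int (?n' 4) + 5 * int (?n' 5) + 15 * int (?n' 6)) \<le> 24 * int ((w + e) choose 4)" by simp
    thus ?thesis unfolding int_choose_four by (simp add: W_def)
  qed
  have pos: "0 < W * (W - 1) * (W - 2) * (W - 4)" using W by simp
  have "(odd e \<or> e > 4) \<or> e = 2 \<or> e = 4" using e(2) by presburger
  then consider "odd e \<or> e > 4" | "e = 2" | "e = 4" by blast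
  thus False
  proof cases
    case 1
    hence "?n 4 = 0" "?n 5 = 0" "?n 6 = 0" using zero[of 4] zero[of 5] zero[of 6] by auto
    thus False using low pos by simp
  next
    case 2
    have n: "?n 4 \<le> ?n' 5" "?n 5 \<le> ?n' 6" "?n 6 = 0"
      using le[of 4 5] le[of 5 6] zero[of 6] 2 by auto
    have "W + int e = W + 2" "W + 2 - 1 = W + 1" "W + 2 - 2 = W" "W + 2 - 3 = W - 1" using 2 by simp_all
    note eqs = this
    \<comment> \<open>Intersection numbers 4 and 5 become 5 and 6, so their weights 1 and 5 rise to
      5 and 15.\<close>
    have "24 * (5 * int (?n 4) + 15 * int (?n 5)) \<le> 24 * (int (?n' 4) + 5 * int (?n' 5) + 15 * int (?n' 6))"
      using n(1,2) by simp
    also have "\<dots> \<le> (W + 2) * (W + 1) * W * (W - 1)" using up by (simp only: eqs)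
    finally have u: "24 * (5 * int (?n 4) + 15 * int (?n 5)) \<le> (W + 2) * (W + 1) * W * (W - 1)" .
    show False
    \<comment> \<open>Both weights grow at least by the factor 3, which gives a contradiction only
      from \<open>W = 10\<close> on. Below that \<open>?n 5\<close> vanishes and the factor 5 is
      available.\<close>
    proof (cases "w < 10")
      case True
      hence "5 * (W * (W - 1) * (W - 2) * (W - 4)) \<le> (W + 2) * (W + 1) * W * (W - 1)"
        using u low zero5 n(3) by simp
      moreover have "W = 7 \<or> W = 8 \<or> W = 9" using True W by (auto simp: W_def)
      ultimately show False by auto
    next
      case False
      hence W10: "W \<ge> 10" by (simp add: W_def)
      have "3 * (W * (W - 1) * (W - 2) * (W - 4)) \<le> (W + 2) * (W + 1) * W * (W - 1)"
        using u low n(3) by simp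
      hence "W * (W - 1) * (3 * ((W - 2) * (W - 4))) \<le> W * (W - 1) * ((W + 2) * (W + 1))"
        by (simp add: algebra_simps)
      moreover have "W * (W - 1) > 0" using W by simp
      ultimately have "3 * ((W - 2) * (W - 4)) \<le> (W + 2) * (W + 1)" by (simp only: mult_le_cancel_left_pos)
      hence "W * (2 * W - 21) + 22 \<le> 0" by (simp add: algebra_simps)
      moreover obtain d where "W = 10 + d" "d \<ge> 0" using W10 by (metis add.commute diff_add_cancel diff_ge_0_iff_ge)
      ultimately have "d * (2 * d + 19) + 12 \<le> 0" by (simp add: algebra_simps)
      thus False using \<open>d \<ge> 0\<close> by (smt (verit) mult_nonneg_nonneg)
    qed
  next
    case 3
    have n: "?n 4 \<le> ?n' 6" "?n 5 = 0" "?n 6 = 0"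
      using le[of 4 6] zero[of 5] zero[of 6] 3 by auto
    have "W + int e = W + 4" "W + 4 - 1 = W + 3" "W + 4 - 2 = W + 2" "W + 4 - 3 = W + 1" using 3 by simp_all
    note eqs = this
    \<comment> \<open>Intersection number 4 becomes 6, so the weight 1 rises to 15.\<close>
    have "24 * (15 * int (?n 4)) \<le> 24 * (int (?n' 4) + 5 * int (?n' 5) + 15 * int (?n' 6))"
      using n(1) by simp
    also have "\<dots> \<le> (W + 4) * (W + 3) * (W + 2) * (W + 1)" using up by (simp only: eqs)
    finally have "24 * (15 * int (?n 4)) \<le> (W + 4) * (W + 3) * (W + 2) * (W + 1)" .
    hence "15 * (W * (W - 1) * (W - 2) * (W - 4)) \<le> (W + 4) * (W + 3) * (W + 2) * (W + 1)"
      using low n by simp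
    \<comment> \<open>After this substitution the difference is a polynomial in \<open>d\<close>
      with negative coefficients only.\<close>
    moreover obtain d where d: "W = 7 + d" "d \<ge> 0" using W by (metis add.commute diff_add_cancel diff_ge_0_iff_ge)
    ultimately have "0 \<le> - (15 * ((7 + d) * (6 + d) * (5 + d) * (3 + d))) + (11 + d) * (10 + d) * (9 + d) * (8 + d)"
      by simp
    also have "\<dots> = - 1530 - 4583 * d - 1876 * d^2 - 277 * d^3 - 14 * d^4"
      by (simp add: algebra_simps power2_eq_square power3_eq_cube power4_eq_xxxx)
    finally show False using d(2) by (smt (verit) zero_le_power mult_nonneg_nonneg)
  qed
qed

text \<open>Strong induction on the distance \<open>w\<close>. The claim is an equivalence, so that
  smaller distances are preserved by \<open>f\<close> and by its inverse, and
  \<open>distance_not_increased\<close> applies to both maps.\<close>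

lemma min_distance_preserving_imp_isometry:
  fixes C C' :: "'a set set" and f :: "'a set \<Rightarrow> 'a set"
  assumes G: "finite G" "card G = 3 * l + 1" "l > 0"
    and C: "C \<subseteq> Pow G" "code6 C" and C': "C' \<subseteq> Pow G" "code6 C'"
    and large: "2 ^ card G \<le> card C * card G ^ 2" and large': "2 ^ card G \<le> card C' * card G ^ 2"
    and f: "bij_betw f C C'"
    and adj: "\<And>u v. u \<in> C \<Longrightarrow> v \<in> C \<Longrightarrow> sdist u v = 6 \<longleftrightarrow> sdist (f u) (f v) = 6"
    and xy: "x \<in> C" "y \<in> C"
  shows "sdist (f x) (f y) = sdist x y"
proof -
  define g where "g = inv_into C f"
  have g: "bij_betw g C' C" unfolding g_def by (rule bij_betw_inv_into[OF f])
  have gf: "g (f u) = u" if "u \<in> C" for u unfolding g_def using f that by (rule bij_betw_inv_into_left)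
  have fg: "f (g u) = u" if "u \<in> C'" for u unfolding g_def using f that by (rule bij_betw_inv_into_right)
  have fC: "f u \<in> C'" if "u \<in> C" for u using f that by (auto simp: bij_betw_def)
  have gC: "g u \<in> C" if "u \<in> C'" for u using g that by (auto simp: bij_betw_def)
  have fin: "finite u" if "u \<in> C \<or> u \<in> C'" for u
    by (rule finite_subset[OF _ G(1)]) (use that C(1) C'(1) in auto)
  have "sdist u v = w \<longleftrightarrow> sdist (f u) (f v) = w" if "u \<in> C" "v \<in> C" for u v w
    using that
  proof (induction w arbitrary: u v rule: less_induct)
    case (less w)
    consider "w = 0" | "0 < w" "w < 6" | "w = 6" | "6 < w" by linarith
    thus ?case
    proof cases
      case 1
      thus ?thesis using less.prems f fC fin by (auto simp: sdist_eq_0_iff bij_betw_def inj_on_def)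
    next
      case 2
      have nw: "sdist a b \<noteq> w" if "code6 K" "a \<in> K" "b \<in> K" for a b and K :: "'a set set"
        using that 2 by (cases "a = b") (fastforce simp: code6_def sdist_def[of b b])+
      have "sdist u v \<noteq> w" using nw[OF C(2)] less.prems by simp
      moreover have "sdist (f u) (f v) \<noteq> w"
        using nw[OF C'(2)] fC less.prems by simp
      ultimately show ?thesis by simp
    next
      case 3
      thus ?thesis using adj less.prems by simp
    next
      case 4
      have "sdist (f u) (f v) \<le> sdist u v" if "sdist u v = w"
        by (rule distance_not_increased[OF G C C' large])
           (use f less that 4 in \<open>auto simp: bij_betw_def\<close>)
      moreover have "sdist (g (f u)) (g (f v)) \<le> sdist (f u) (f v)" if "sdist (f u) (f v) = w"
      proof (rule distance_not_increased[OF G C' C large'])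
        show "sdist (g a) (g b) = sdist a b"
          if "a \<in> C'" "b \<in> C'" "sdist a b < sdist (f u) (f v)" for a b
          using less.IH[of "sdist a b" "g a" "g b"] that gC fg \<open>sdist (f u) (f v) = w\<close> by auto
      qed (use g fC less.prems that 4 in \<open>auto simp: bij_betw_def\<close>)
      \<comment> \<open>A smaller distance between the images would, by the induction hypothesis, be
        the distance of \<open>u\<close> and \<open>v\<close> as well.\<close>
      moreover have "\<not> sdist (f u) (f v) < w" if "sdist u v = w"
        using less.IH[of "sdist (f u) (f v)" u v] less.prems that by auto
      moreover have "\<not> sdist u v < w" if "sdist (f u) (f v) = w"
        using less.IH[of "sdist u v" u v] less.prems that by auto
      ultimately show ?thesis using gf less.prems by fastforce
    qed
  qed
  thus ?thesis using xy by metis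
qed

section \<open>A code attaining the bound\<close>

lemma two_eq_0: "(2::bit alg_closure) = 0"
  using to_ac_numeral[of "num.Bit0 num.One", where 'a=bit] by simp

text \<open>These are the roots of \<open>X ^ q + X\<close>, where \<open>q = 2 ^ k\<close>, in the
  algebraic closure of the field of two elements. The Frobenius identity makes them closed under
  addition, and the derivative 1 excludes multiple roots, so there are \<open>q\<close> of
  them.\<close>

lemma exists_subfield_of_order_two_power:
  assumes "k > 0"
  obtains F :: "bit alg_closure set" where
    "card F = 2 ^ k" "F = {x. x ^ 2 ^ k = x}"
    "\<And>x y. x \<in> F \<Longrightarrow> y \<in> F \<Longrightarrow> x + y \<in> F"
proof -
  define q :: nat where "q = 2 ^ k"
  have q: "q > 1" unfolding q_def by (rule one_less_power) (use assms in auto)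
  define F :: "bit alg_closure set" where "F = {x. x ^ q = x}"
  have "CHAR(bit alg_closure) = 2"
    by (rule CHAR_eqI, use two_eq_0 in simp) (metis two_eq_0 add_0 dvd_def even_two_times_div_two mult_zero_left of_nat_1 of_nat_add of_nat_mult of_nat_numeral oddE zero_neq_one)
  hence dream: "(x + y) ^ q = x ^ q + y ^ q" for x y :: "bit alg_closure"
    using freshmans_dream'[of q k x y] by (simp add: q_def)
  define p :: "bit alg_closure poly" where "p = monom 1 q + monom 1 1"
  have deg: "degree p = q"
    using q by (simp add: p_def degree_add_eq_left degree_monom_eq)
  hence p0: "p \<noteq> 0" using q by auto
  have roots: "poly p x = 0 \<longleftrightarrow> x \<in> F" for x
  proof -
    have "poly p x = x ^ q + x" by (simp add: p_def poly_monom)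
    moreover have "-x = x" using two_eq_0 by (metis add.inverse_unique mult_2 mult_zero_left)
    ultimately show ?thesis using eq_neg_iff_add_eq_0[of "x ^ q" x] by (simp only: F_def mem_Collect_eq)
  qed
  have "(of_nat q :: bit alg_closure) = 0"
    using two_eq_0 assms by (simp add: q_def power_0_left)
  hence der: "pderiv p = 1"
    by (simp add: p_def pderiv_add pderiv_monom)
  obtain R where R: "size R = degree p" "p = smult (lead_coeff p) (\<Prod>x\<in>#R. [:-x, 1:])"
    using alg_closed_imp_factorization[OF p0] by blast
  have set_R: "set_mset R = F"
  proof -
    have "poly p x = 0 \<longleftrightarrow> x \<in># R" for x
      using p0 by (subst R(2)) (auto simp: poly_prod_mset prod_mset_zero_iff)
    thus ?thesis using roots by auto
  qed
  have "count R x \<le> 1" for x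
  proof (rule ccontr)
    assume "\<not> count R x \<le> 1"
    hence "{#x, x#} \<subseteq># R" by (auto simp: subseteq_mset_def)
    then obtain R' where R': "R = {#x, x#} + R'" by (auto simp: mset_subset_eq_exists_conv)
    define r where "r = smult (lead_coeff p) (\<Prod>x\<in>#R'. [:-x, 1:])"
    have "p = [:-x, 1:] * ([:-x, 1:] * r)"
      by (subst R(2)) (simp only: R' r_def image_mset_union image_mset_add_mset prod_mset.union
        prod_mset.add_mset image_mset_empty prod_mset.empty mult_smult_right mult_1_right mult.assoc)
    hence "poly (pderiv p) x = 0" by (simp only: pderiv_mult poly_add poly_mult) simp
    thus False using der by simp
  qed
  hence "R = mset_set (set_mset R)"
    by (intro multiset_eqI) (auto simp: count_mset_set' not_in_iff intro!: le_antisym)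
  hence "size R = card (set_mset R)" by (metis size_mset_set)
  hence "card F = q" using R(1) deg set_R by simp
  moreover have "x + y \<in> F" if "x \<in> F" "y \<in> F" for x y
    using that dream by (simp add: F_def)
  ultimately show thesis using that[of F] by (simp add: F_def q_def)
qed

text \<open>The finite field is a set inside a larger field type. Its Frobenius equation yields
  closure under products and quotients, and odd degree makes cubing a permutation.\<close>

locale odd_binary_field =
  fixes F :: "'a::field set" and k :: nat
  assumes char2: "(x::'a) + x = 0"
    and card_F: "card F = 2 ^ k" and odd_k: "odd k"
    and F_eq: "F = {x. x ^ 2 ^ k = x}"
    and add_closed: "x \<in> F \<Longrightarrow> y \<in> F \<Longrightarrow> x + y \<in> F"
begin

lemma finite_F: "finite F"
  using card_F by (metis card.infinite power_not_zero zero_neq_numeral)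

lemma zero_closed: "0 \<in> F" and one_closed: "1 \<in> F"
  by (simp_all add: F_eq)

lemma mult_closed: "x \<in> F \<Longrightarrow> y \<in> F \<Longrightarrow> x * y \<in> F"
  by (simp add: F_eq power_mult_distrib)

lemma divide_closed: "x \<in> F \<Longrightarrow> y \<in> F \<Longrightarrow> x / y \<in> F"
  by (simp add: F_eq power_divide)

lemma power_closed: "x \<in> F \<Longrightarrow> x ^ n \<in> F"
  by (induction n) (simp_all add: one_closed mult_closed)

lemma sum_closed: "(\<And>x. x \<in> S \<Longrightarrow> f x \<in> F) \<Longrightarrow> sum f S \<in> F"
  by (induction S rule: infinite_finite_induct) (simp_all add: zero_closed add_closed)

lemma add_cancel: "(x::'a) + (x + y) = y"
  by (simp add: char2 flip: add.assoc)

lemma add_eq_0: "(x::'a) + y = 0 \<longleftrightarrow> x = y"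
  by (metis add_cancel add_0_right)

lemma sum_sym_diff:
  fixes f :: "'a \<Rightarrow> 'a"
  assumes "finite A" "finite B"
  shows "sum f (sym_diff A B) = sum f A + sum f B"
proof -
  have A: "sum f A = sum f (A - B) + sum f (A \<inter> B)"
    using assms by (metis add.commute sum.Int_Diff)
  have B: "sum f B = sum f (B - A) + sum f (A \<inter> B)"
    using assms by (metis add.commute sum.Int_Diff Int_commute)
  have "sum f (sym_diff A B) = sum f (A - B) + sum f (B - A)"
    using assms by (intro sum.union_disjoint) auto
  also have "\<dots> = sum f A + sum f B"
    unfolding A B using char2[of "sum f (A \<inter> B)"] add_cancel
    by (simp only: add.assoc add.left_commute[of "sum f (A \<inter> B)"] add_0_right)
  finally show ?thesis .
qed

text \<open>A root would generate the field of four elements, which is no subfield as \<open>k\<close> is odd.\<close>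
lemma no_cube_root_of_unity:
  assumes "x \<in> F"
  shows "x ^ 2 + x + 1 \<noteq> 0"
proof
  assume *: "x ^ 2 + x + 1 = 0"
  hence sq: "x ^ 2 = x + 1" by (metis add.assoc add_eq_0)
  have "x ^ 4 = (x ^ 2) ^ 2" by (simp flip: power_mult)
  also have "\<dots> = (x + 1) ^ 2" by (simp only: sq)
  also have "\<dots> = x ^ 2 + 1 + (x + x)" by (simp add: power2_eq_square algebra_simps)
  also have "\<dots> = x" by (simp only: sq char2 add.assoc add_0_right)
  finally have four: "x ^ 4 = x" .
  have pow: "x ^ 4 ^ j = x" for j
    by (induction j) (simp_all add: power_mult four)
  obtain j where "k = 2 * j + 1" using odd_k oddE by blast
  hence "2 ^ k = 4 ^ j * (2::nat)" by (simp add: power_mult)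
  hence "x ^ 2 ^ k = (x ^ 4 ^ j) ^ 2" by (simp only: power_mult)
  hence "x ^ 2 = x" using assms pow by (simp add: F_eq)
  hence "x + 1 = x" using sq by simp
  thus False by simp
qed

text \<open>The quotient of two distinct elements with equal cubes would be a nontrivial cube root
  of unity, hence a root of \<open>z ^ 2 + z + 1\<close>.\<close>

lemma bij_betw_cube: "bij_betw (\<lambda>x. x ^ 3) F F"
proof -
  have inj: "inj_on (\<lambda>x. x ^ 3) F"
  proof (rule inj_onI, rule ccontr)
    fix x y assume xy: "x \<in> F" "y \<in> F" "x ^ 3 = y ^ 3" "x \<noteq> y"
    hence "y \<noteq> 0" by auto
    define z where "z = x / y"
    have z: "z \<in> F" "z \<noteq> 1" "z ^ 3 = 1"
      using xy \<open>y \<noteq> 0\<close> by (simp_all add: z_def divide_closed power_divide)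
    have "(z + 1) * (z ^ 2 + z + 1) = z ^ 3 + 1 + ((z ^ 2 + z ^ 2) + (z + z))"
      by (simp add: algebra_simps power2_eq_square power3_eq_cube)
    hence "(z + 1) * (z ^ 2 + z + 1) = 0" using z(3) by (simp only: char2 add_0_right)
    moreover have "z + 1 \<noteq> 0" using z(2) add_eq_0[of z 1] by simp
    ultimately show False using no_cube_root_of_unity[OF z(1)] by (metis mult_eq_0_iff)
  qed
  moreover have "(\<lambda>x. x ^ 3) ` F \<subseteq> F" by (auto simp: power_closed)
  ultimately show ?thesis by (simp add: bij_betw_def endo_inj_surj[OF finite_F])
qed

section \<open>Even sets and their syndromes\<close>

definition syndrome :: "'a set \<Rightarrow> 'a \<times> 'a" where
  "syndrome S = (\<Sum>S, \<Sum>x\<in>S. x ^ 3)"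

text \<open>The even sets of syndrome \<open>(0, 0)\<close> form the extended
  double-error-correcting BCH code: the element 0 contributes to neither sum and serves as the
  parity coordinate.\<close>

definition evens :: "'a set set" where
  "evens = {S. S \<subseteq> F \<and> even (card S)}"

lemma finite_subset_F: "S \<subseteq> F \<Longrightarrow> finite S"
  using finite_F finite_subset by blast

lemma evens_sym_diff: "A \<in> evens \<Longrightarrow> B \<in> evens \<Longrightarrow> sym_diff A B \<in> evens"
  using even_card_sym_diff[OF finite_subset_F finite_subset_F] by (auto simp: evens_def)

lemma syndrome_sym_diff:
  assumes "finite A" "finite B"
  shows "syndrome (sym_diff A B) = (fst (syndrome A) + fst (syndrome B), snd (syndrome A) + snd (syndrome B))"
  using sum_sym_diff[OF assms] by (simp add: syndrome_def)

lemma syndrome_closed: "S \<subseteq> F \<Longrightarrow> syndrome S \<in> F \<times> F"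
  by (auto simp: syndrome_def intro!: sum_closed power_closed)

lemma finite_evens: "finite evens"
  by (rule finite_subset[of _ "Pow F"]) (auto simp: evens_def finite_F)

text \<open>Toggling the element 0 matches the even subsets with the odd ones.\<close>

lemma card_evens: "2 * card evens = 2 ^ card F"
proof -
  let ?odds = "Pow F - evens"
  have "card evens = card ?odds"
  proof (rule bij_betw_same_card[of "\<lambda>S. sym_diff S {0}"],
      rule bij_betw_byWitness[where f' = "\<lambda>S. sym_diff S {0}"])
    have e: "sym_diff S {0} \<subseteq> F \<and> (even (card (sym_diff S {0})) \<longleftrightarrow> odd (card S))"
      if "S \<subseteq> F" for S
      using even_card_sym_diff[OF finite_subset_F[OF that], of "{0}"] that zero_closed by auto
    show "(\<lambda>S. sym_diff S {0}) ` evens \<subseteq> ?odds" "(\<lambda>S. sym_diff S {0}) ` ?odds \<subseteq> evens"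
      using e by (auto simp only: evens_def Pow_iff Diff_iff mem_Collect_eq image_subset_iff)
  qed auto
  moreover have "evens \<subseteq> Pow F" by (auto simp: evens_def)
  hence "card (Pow F) = card evens + card ?odds"
    using finite_F finite_evens by (metis card_Diff_subset card_mono finite_Pow_iff le_add_diff_inverse)
  ultimately show ?thesis using finite_F by (simp add: card_Pow)
qed

text \<open>The pair of \<open>0\<close> and \<open>a\<close> realises \<open>(a, a ^ 3)\<close>.
  Adding such pairs for \<open>x\<close>, \<open>y\<close> and \<open>x + y\<close> realises
  \<open>(0, x ^ 2 * y + x * y ^ 2)\<close>. With \<open>y = x * t\<close> the second entry is
  \<open>x ^ 3\<close> times the fixed nonzero \<open>t ^ 2 + t\<close>, which is arbitrary since
  cubing is onto.\<close>

lemma syndrome_surj: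
  assumes "a \<in> F" "b \<in> F" "2 < card F"
  obtains Y where "Y \<in> evens" "syndrome Y = (a, b)"
proof -
  have pair: "\<exists>Y\<in>evens. syndrome Y = (a, a ^ 3)" if "a \<in> F" for a
  proof (cases "a = 0")
    case True
    thus ?thesis by (intro bexI[of _ "{}"]) (auto simp: evens_def syndrome_def)
  next
    case False
    thus ?thesis using that zero_closed
      by (intro bexI[of _ "{0, a}"]) (auto simp: evens_def syndrome_def)
  qed
  have "\<exists>Y\<in>evens. syndrome Y = (0, c)" if "c \<in> F" for c
  proof -
    have "\<not> F \<subseteq> {0, 1}" using assms(3) card_mono[of "{0,1}" F] by auto
    then obtain t where t: "t \<in> F" "t \<noteq> 0" "t \<noteq> 1" by auto
    have t': "t ^ 2 + t \<in> F" using t by (simp add: add_closed power_closed)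
    have t0: "t ^ 2 + t \<noteq> 0" using t by (simp add: add_eq_0 power2_eq_square)
    have "c / (t ^ 2 + t) \<in> F" using that t' by (simp add: divide_closed)
    then obtain x where x: "x \<in> F" "x ^ 3 = c / (t ^ 2 + t)"
      using bij_betw_cube by (metis (no_types, lifting) bij_betw_def image_iff)
    define y where "y = x * t"
    have y: "y \<in> F" using x t by (simp add: y_def mult_closed)
    obtain A where A: "A \<in> evens" "syndrome A = (x, x ^ 3)" using pair[OF x(1)] by blast
    obtain B where B: "B \<in> evens" "syndrome B = (y, y ^ 3)" using pair[OF y] by blast
    obtain D where D: "D \<in> evens" "syndrome D = (x + y, (x + y) ^ 3)"
      using pair[OF add_closed[OF x(1) y]] by blast
    have fin: "finite A" "finite B" "finite D" "finite (sym_diff A B)"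
      using A B D finite_subset_F by (auto simp: evens_def)
    have "syndrome (sym_diff (sym_diff A B) D) = (x + y + (x + y), x ^ 3 + y ^ 3 + (x + y) ^ 3)"
      using syndrome_sym_diff[OF fin(4,3)] syndrome_sym_diff[OF fin(1,2)] A B D by simp
    also have "x ^ 3 + y ^ 3 + (x + y) ^ 3 = x ^ 2 * y + x * y ^ 2
        + ((x ^ 3 + x ^ 3) + (y ^ 3 + y ^ 3) + (x ^ 2 * y + x ^ 2 * y) + (x * y ^ 2 + x * y ^ 2))"
      by (simp add: power2_eq_square power3_eq_cube algebra_simps)
    also have "\<dots> = x ^ 3 * (t ^ 2 + t)"
      by (simp only: char2 add_0_right) (simp add: y_def power2_eq_square power3_eq_cube algebra_simps)
    also have "\<dots> = c" using x(2) t0 by simp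
    finally have "syndrome (sym_diff (sym_diff A B) D) = (0, c)" by (simp only: char2)
    thus ?thesis using evens_sym_diff[OF evens_sym_diff] A B D by blast
  qed
  \<comment> \<open>The target \<open>(a, b)\<close> is the sum of \<open>(a, a ^ 3)\<close> and
    \<open>(0, a ^ 3 + b)\<close>.\<close>
  moreover have "a ^ 3 + b \<in> F" using assms by (simp add: add_closed power_closed)
  ultimately obtain Y where Y: "Y \<in> evens" "syndrome Y = (0, a ^ 3 + b)" by blast
  obtain Z where Z: "Z \<in> evens" "syndrome Z = (a, a ^ 3)" using pair[OF assms(1)] by blast
  have "finite Y" "finite Z" using Y Z finite_subset_F by (auto simp: evens_def)
  hence "syndrome (sym_diff Z Y) = (a, b)"
    using Y Z by (simp add: syndrome_sym_diff add_cancel)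
  thus thesis using that evens_sym_diff[OF Z(1) Y(1)] by blast
qed

text \<open>Translation by an even set whose syndrome is the componentwise sum of \<open>s\<close>
  and \<open>s'\<close> maps one fibre into the other, so all \<open>card F ^ 2\<close> fibres have
  equal size.\<close>

lemma card_syndrome_fibre:
  assumes "a \<in> F" "b \<in> F" "2 < card F"
  shows "card F ^ 2 * card {Y \<in> evens. syndrome Y = (a, b)} = card evens"
proof -
  let ?f = "\<lambda>s. {Y \<in> evens. syndrome Y = s}"
  have le: "card (?f s) \<le> card (?f s')" if ss: "s \<in> F \<times> F" "s' \<in> F \<times> F" for s s'
  proof -
    have "fst s + fst s' \<in> F" "snd s + snd s' \<in> F" using ss by (auto simp: add_closed)
    then obtain Z where Z: "Z \<in> evens" "syndrome Z = (fst s + fst s', snd s + snd s')"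
      using syndrome_surj assms(3) by blast
    have "syndrome (sym_diff Y Z) = s'" if "Y \<in> evens" "syndrome Y = s" for Y
    proof -
      have "finite Y" "finite Z" using Z(1) that finite_subset_F by (auto simp: evens_def)
      thus ?thesis using Z that by (simp add: syndrome_sym_diff add_cancel)
    qed
    hence "(\<lambda>Y. sym_diff Y Z) ` ?f s \<subseteq> ?f s'" using evens_sym_diff[OF _ Z(1)] by auto
    moreover have "inj_on (\<lambda>Y. sym_diff Y Z) (?f s)"
      by (rule inj_on_inverseI[where g = "\<lambda>Y. sym_diff Y Z"]) auto
    ultimately show ?thesis using finite_evens by (intro card_inj_on_le) auto
  qed
  have "card evens = card (\<Union>s\<in>F \<times> F. ?f s)"
    using syndrome_closed by (intro arg_cong[of _ _ card]) (auto simp: evens_def)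
  also have "\<dots> = (\<Sum>s\<in>F \<times> F. card (?f s))"
    using finite_F finite_evens by (intro card_UN_disjoint) auto
  also have "\<dots> = (\<Sum>s\<in>F \<times> F. card (?f (a, b)))"
    using le assms by (intro sum.cong refl antisym) auto
  finally show ?thesis by (simp add: card_cartesian_product power2_eq_square)
qed

text \<open>The description of the Preparata code by Baker, van Lint and Wilson, for the Frobenius
  automorphism \<open>x \<mapsto> x\<^sup>2\<close>.\<close>
definition bvw_code :: "('a + 'a) set set" where
  "bvw_code = {S <+> Y | S Y. S \<in> evens \<and> Y \<in> evens \<and>
     syndrome Y = (\<Sum>S, (\<Sum>x\<in>S. x ^ 3) + (\<Sum>S) ^ 3)}"

text \<open>For each even \<open>S\<close> the admissible \<open>Y\<close> form one syndrome fibre.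
  With \<open>n = 2 * card F\<close> this amounts to \<open>2 ^ n / n ^ 2\<close> words, exactly the
  Johnson bound.\<close>

lemma card_bvw_code:
  assumes "2 < card F"
  shows "card bvw_code * (2 * card F) ^ 2 = 2 ^ (2 * card F)"
proof -
  let ?s = "\<lambda>S. (\<Sum>S, (\<Sum>x\<in>S. x ^ 3) + (\<Sum>S) ^ 3)"
  let ?P = "SIGMA S:evens. {Y \<in> evens. syndrome Y = ?s S}"
  have "bvw_code = (\<lambda>(S, Y). S <+> Y) ` ?P"
    by (auto simp: bvw_code_def)
  moreover have "inj_on (\<lambda>(S, Y). S <+> Y) ?P"
    by (auto simp: inj_on_def Plus_def)
  ultimately have "card bvw_code = card ?P" by (simp add: card_image)
  also have "\<dots> = (\<Sum>S\<in>evens. card {Y \<in> evens. syndrome Y = ?s S})"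
    using finite_evens by simp
  finally have "card F ^ 2 * card bvw_code
      = (\<Sum>S\<in>evens. card F ^ 2 * card {Y \<in> evens. syndrome Y = ?s S})"
    by (simp add: sum_distrib_left)
  also have "\<dots> = (\<Sum>S\<in>evens. card evens)"
  proof (intro sum.cong refl card_syndrome_fibre assms)
    fix S assume "S \<in> evens"
    hence "\<Sum>S \<in> F" "(\<Sum>x\<in>S. x ^ 3) \<in> F"
      using syndrome_closed[of S] by (auto simp: evens_def syndrome_def)
    thus "\<Sum>S \<in> F" "(\<Sum>x\<in>S. x ^ 3) + (\<Sum>S) ^ 3 \<in> F"
      by (simp_all add: add_closed power_closed)
  qed
  finally have "card F ^ 2 * card bvw_code = card evens ^ 2" by (simp add: power2_eq_square)
  hence "card bvw_code * (2 * card F) ^ 2 = (2 * card evens) ^ 2"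
    by (simp add: power_mult_distrib mult.commute)
  also have "(2 * card evens) ^ 2 = 2 ^ (2 * card F)"
    unfolding card_evens by (simp add: mult.commute flip: power_mult)
  finally show ?thesis .
qed

section \<open>Minimum distance of the code\<close>

lemma cube_sum_eq: "(x::'a) ^ 3 + (x + a) ^ 3 = a ^ 3 + x ^ 2 * a + x * a ^ 2"
proof -
  have "x ^ 3 + (x + a) ^ 3 = a ^ 3 + x ^ 2 * a + x * a ^ 2
      + ((x ^ 3 + x ^ 3) + (x ^ 2 * a + x ^ 2 * a) + (x * a ^ 2 + x * a ^ 2))"
    by (simp add: power2_eq_square power3_eq_cube algebra_simps)
  thus ?thesis by (simp only: char2 add_0_right)
qed

text \<open>With \<open>d = a + b + c\<close> the sum of the cubes factors as
  \<open>(a + b) * (a + c) * (b + c)\<close> in characteristic 2, which is nonzero for distinct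
  elements.\<close>

lemma four_set_syndrome:
  fixes A :: "'a set"
  assumes "card A = 4" "\<Sum>A = 0"
  shows "(\<Sum>x\<in>A. x ^ 3) \<noteq> 0"
proof -
  obtain a b c d where A: "A = {a, b, c, d}" "distinct [a, b, c, d]"
    using assms(1) by (auto simp: card_Suc_eq numeral_eq_Suc)
  have "a + (b + (c + d)) = 0" using assms(2) A by simp
  hence "c + (a + b) + d = 0" by (simp only: add_ac)
  hence d: "d = c + (a + b)" by (rule add_eq_0[THEN iffD1, symmetric])
  define u where "u = a + b"
  have "a ^ 3 + b ^ 3 = u ^ 3 + a ^ 2 * u + a * u ^ 2"
    using cube_sum_eq[of a u] by (simp only: u_def add_cancel)
  moreover have "c ^ 3 + d ^ 3 = u ^ 3 + c ^ 2 * u + c * u ^ 2"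
    using cube_sum_eq[of c u] by (simp only: u_def d)
  ultimately have "a ^ 3 + b ^ 3 + (c ^ 3 + d ^ 3) + (u * a * c + u * a * c)
      = u * ((a + c) * (a + c + u)) + (u ^ 3 + u ^ 3)"
    by (simp add: power2_eq_square power3_eq_cube algebra_simps)
  hence "a ^ 3 + b ^ 3 + (c ^ 3 + d ^ 3) = u * ((a + c) * (a + c + u))"
    by (simp only: char2 add_0_right)
  moreover have "a + c + u = b + c"
    by (simp only: u_def add_cancel add.assoc add.left_commute[of c a])
      (simp only: add.commute)
  hence "u \<noteq> 0 \<and> a + c \<noteq> 0 \<and> a + c + u \<noteq> 0"
    using A(2) by (simp only: u_def add_eq_0) auto
  hence "u * ((a + c) * (a + c + u)) \<noteq> 0" by (simp only: mult_eq_0_iff) blast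
  ultimately show ?thesis using A by (simp add: add.assoc)
qed

text \<open>Two words differ by \<open>A <+> B\<close> with both parts of even size and equal sums.
  Below distance 6 there is a lone pair, excluded by its nonzero sum, a lone quadruple, excluded by
  \<open>four_set_syndrome\<close>, or a pair on each side, which leads to a root of
  \<open>z ^ 2 + z + 1\<close> in \<open>F\<close>.\<close>

lemma code6_bvw_code: "code6 bvw_code"
  unfolding code6_def
proof (intro ballI impI, rule ccontr)
  fix P P' assume P: "P \<in> bvw_code" and P': "P' \<in> bvw_code" and "P \<noteq> P'" and "\<not> 6 \<le> sdist P P'"
  obtain S Y where XY: "P = S <+> Y" "S \<in> evens" "Y \<in> evens" "\<Sum>Y = \<Sum>S"
      "(\<Sum>y\<in>Y. y ^ 3) = (\<Sum>x\<in>S. x ^ 3) + (\<Sum>S) ^ 3"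
    using P by (auto simp: bvw_code_def syndrome_def)
  obtain S' Y' where XY': "P' = S' <+> Y'" "S' \<in> evens" "Y' \<in> evens" "\<Sum>Y' = \<Sum>S'"
      "(\<Sum>y\<in>Y'. y ^ 3) = (\<Sum>x\<in>S'. x ^ 3) + (\<Sum>S') ^ 3"
    using P' by (auto simp: bvw_code_def syndrome_def)
  define A where "A = sym_diff S S'"
  define B where "B = sym_diff Y Y'"
  have fin: "finite S" "finite S'" "finite Y" "finite Y'"
    using XY XY' finite_subset_F by (auto simp: evens_def)
  have ev: "A \<in> evens" "B \<in> evens" using evens_sym_diff XY XY' by (auto simp only: A_def B_def)
  hence finAB: "finite A" "finite B" and AF: "A \<subseteq> F" "B \<subseteq> F" using finite_subset_F by (auto simp: evens_def)
  have "sym_diff P P' = A <+> B" by (auto simp: XY(1) XY'(1) A_def B_def)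
  hence "card A + card B < 6" using \<open>\<not> 6 \<le> sdist P P'\<close> finAB by (simp add: sdist_def card_Plus)
  moreover have "A \<noteq> {} \<or> B \<noteq> {}" using \<open>P \<noteq> P'\<close> unfolding XY(1) XY'(1) A_def B_def by blast
  hence "0 < card A \<or> 0 < card B" using finAB by (simp add: card_gt_0_iff)
  moreover obtain i j where ij: "card A = 2 * i" "card B = 2 * j" using ev by (auto simp: evens_def elim!: evenE)
  ultimately have "i + j < 3" "i + j > 0" by auto
  hence cases: "(i = 1 \<and> j = 0) \<or> (i = 0 \<and> j = 1) \<or> (i = 2 \<and> j = 0) \<or> (i = 0 \<and> j = 2) \<or> (i = 1 \<and> j = 1)"
    by presburger
  have s1: "\<Sum>B = \<Sum>A"
    using sum_sym_diff[OF fin(1,2), of "\<lambda>x. x"] sum_sym_diff[OF fin(3,4), of "\<lambda>x. x"] XY(4) XY'(4)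
    by (simp add: A_def B_def)
  define r where "r = \<Sum>S"
  define a where "a = \<Sum>A"
  have rF: "r \<in> F" "a \<in> F"
    using syndrome_closed[of S] syndrome_closed[OF AF(1)] XY(2) by (auto simp: r_def a_def syndrome_def evens_def)
  have ra: "\<Sum>S' = r + a"
    using sum_sym_diff[OF fin(1,2), of "\<lambda>x. x"] by (simp only: r_def a_def A_def add_cancel)
  \<comment> \<open>Cubing is not additive, so the difference of the two cube conditions depends on
    \<open>r\<close> besides \<open>A\<close> and \<open>B\<close>.\<close>
  have s3: "(\<Sum>x\<in>B. x ^ 3) = (\<Sum>x\<in>A. x ^ 3) + (a ^ 3 + r ^ 2 * a + r * a ^ 2)"
  proof -
    have "(\<Sum>x\<in>B. x ^ 3) = (\<Sum>x\<in>A. x ^ 3) + (r ^ 3 + (r + a) ^ 3)"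
      using sum_sym_diff[OF fin(1,2), of "\<lambda>x. x ^ 3"] sum_sym_diff[OF fin(3,4), of "\<lambda>x. x ^ 3"] XY(5) XY'(5) ra
      by (simp add: A_def B_def r_def add_ac)
    thus ?thesis by (simp only: cube_sum_eq)
  qed
  have two: "\<exists>x. D = {x, x + \<Sum>D} \<and> \<Sum>D \<noteq> 0" if card: "card D = 2" for D :: "'a set"
  proof -
    obtain x y where "D = {x, y}" "x \<noteq> y" using card unfolding card_2_iff by blast
    thus ?thesis by (intro exI[of _ x]) (auto simp: add_cancel add_eq_0)
  qed
  consider "i = 1" "j = 0" | "i = 0" "j = 1" | "i = 2" "j = 0" | "i = 0" "j = 2" | "i = 1" "j = 1"
    using cases by blast
  thus False
  proof cases
    case 1 thus False using two[of A] ij s1 finAB by auto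
  next
    case 2 thus False using two[of B] ij s1 finAB by auto
  next
    case 3
    hence "B = {}" using ij finAB by simp
    hence "a = 0" using s1 by (simp add: a_def)
    thus False using four_set_syndrome[of A] s3 ij 3 \<open>B = {}\<close> by (simp add: a_def)
  next
    case 4
    hence "A = {}" using ij finAB by simp
    hence "a = 0" by (simp add: a_def)
    thus False using four_set_syndrome[of B] s1 s3 ij 4 \<open>A = {}\<close> by (simp add: a_def)
  next
    case 5
    then obtain x y where x: "A = {x, x + a}" "a \<noteq> 0" and y: "B = {y, y + a}"
      using two[of A] two[of B] ij s1 by (auto simp: a_def)
    have xy: "x \<in> F" "y \<in> F" using AF x(1) y by auto
    have "y ^ 3 + (y + a) ^ 3 = x ^ 3 + (x + a) ^ 3 + (a ^ 3 + r ^ 2 * a + r * a ^ 2)"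
      using s3 x y by simp
    hence eq: "a ^ 3 + y ^ 2 * a + y * a ^ 2 = a ^ 3 + x ^ 2 * a + x * a ^ 2 + (a ^ 3 + r ^ 2 * a + r * a ^ 2)"
      by (simp only: cube_sum_eq)
    \<comment> \<open>This choice absorbs \<open>r\<close>; division by \<open>a ^ 3\<close> then
      leaves \<open>z ^ 2 + z + 1\<close> at \<open>z = s / a\<close>.\<close>
    define s where "s = x + y + r"
    have "a ^ 3 + s ^ 2 * a + s * a ^ 2 + (a ^ 3 + a ^ 3) = (a ^ 3 + y ^ 2 * a + y * a ^ 2)
       + (a ^ 3 + x ^ 2 * a + x * a ^ 2 + (a ^ 3 + r ^ 2 * a + r * a ^ 2))
       + ((x * y * a + x * y * a) + (x * r * a + x * r * a) + (y * r * a + y * r * a))"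
      by (simp add: s_def power2_eq_square power3_eq_cube algebra_simps)
    hence "a ^ 3 + s ^ 2 * a + s * a ^ 2 = 0" by (simp only: eq char2 add_0_right)
    moreover have "a ^ 3 + s ^ 2 * a + s * a ^ 2 = a ^ 3 * ((s / a) ^ 2 + s / a + 1)"
      using x(2) by (simp add: field_simps power2_eq_square power3_eq_cube)
    moreover have "s / a \<in> F" using xy rF by (simp add: s_def add_closed divide_closed)
    ultimately show False using no_cube_root_of_unity[of "s / a"] x(2) by simp
  qed
qed

end

section \<open>Preparata codes\<close>

definition support :: "bool list \<Rightarrow> nat set" where
  "support x = {i. i < length x \<and> x ! i}"

lemma support_subset: "x \<in> bin_vectors n \<Longrightarrow> support x \<subseteq> {..<n}"
  by (auto simp: support_def bin_vectors_def)

lemma inj_on_support: "inj_on support (bin_vectors n)"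
  by (rule inj_onI, rule nth_equalityI) (auto simp: support_def bin_vectors_def set_eq_iff)

lemma hamming_eq_sdist:
  assumes "x \<in> bin_vectors n" "y \<in> bin_vectors n"
  shows "hamming x y = sdist (support x) (support y)"
  unfolding hamming_def sdist_def
  by (rule arg_cong[of _ _ card]) (use assms in \<open>auto simp: support_def bin_vectors_def\<close>)

lemma finite_bin_vectors: "finite (bin_vectors n)"
  by (rule inj_on_finite[OF inj_on_support, of n "Pow {..<n}"]) (use support_subset in auto)

text \<open>As \<open>m\<close> is even, \<open>k = m - 1\<close> is odd, and two copies of the
  field of order \<open>2 ^ k\<close> provide \<open>2 ^ m\<close> coordinates. The bijection
  \<open>h\<close> numbers them.\<close>

lemma exists_large_code:
  assumes "even m" "4 \<le> m"
  shows "\<exists>D. D \<subseteq> bin_vectors (2 ^ m) \<and> dist_at_least D 6 \<and> card D * (2 ^ m) ^ 2 = 2 ^ 2 ^ m"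
proof -
  define n :: nat where "n = 2 ^ m"
  obtain k where k: "m = Suc k" "odd k" "k \<ge> 2"
    using assms by (cases m) auto
  obtain F :: "bit alg_closure set" where F: "card F = 2 ^ k" "F = {x. x ^ 2 ^ k = x}"
    "\<And>x y. x \<in> F \<Longrightarrow> y \<in> F \<Longrightarrow> x + y \<in> F"
    by (rule exists_subfield_of_order_two_power[of k]) (use k in auto)
  interpret odd_binary_field F k
  proof
    show "x + x = 0" for x :: "bit alg_closure" using two_eq_0 by (metis mult_2 mult_zero_left)
  qed (use F k in auto)
  let ?P = "bvw_code"
  have cF: "2 * card F = n" using F(1) k by (simp add: n_def)
  have "2 ^ 2 \<le> (2::nat) ^ k" using k(3) by (intro power_increasing) auto
  hence "2 < card F" using F(1) by simp
  note cP = card_bvw_code[OF this, unfolded cF]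
  have PG: "p \<subseteq> F <+> F" if "p \<in> ?P" for p using that by (auto simp: bvw_code_def evens_def)
  have fG: "finite (F <+> F)" and cG: "card (F <+> F) = n"
    using finite_F cF by (simp_all add: card_Plus)
  obtain h where h: "bij_betw h (F <+> F) {0..<n}"
    using ex_bij_betw_finite_nat[OF fG] cG by auto
  define v where "v p = map (\<lambda>i. i \<in> h ` p) [0..<n]" for p
  have vn: "v p \<in> bin_vectors n" for p by (simp add: v_def bin_vectors_def)
  have length_v: "length (v p) = n" for p by (simp add: v_def)
  have nth_v: "v p ! i \<longleftrightarrow> i \<in> h ` p" if "i < n" for p i using that by (simp add: v_def)
  have d: "hamming (v p) (v p') = sdist p p'" if "p \<in> ?P" "p' \<in> ?P" for p p'
  proof -
    have hs: "h ` p \<subseteq> {0..<n}" "h ` p' \<subseteq> {0..<n}"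
      using h PG[OF that(1)] PG[OF that(2)] by (auto simp: bij_betw_def)
    have inj: "inj_on h (F <+> F)" using h by (simp add: bij_betw_def)
    have set: "{i. i < n \<and> (i \<in> A) \<noteq> (i \<in> B)} = sym_diff A B"
      if "A \<subseteq> {0..<n}" "B \<subseteq> {0..<n}" for A B using that by auto
    have "{i. i < length (v p) \<and> v p ! i \<noteq> v p' ! i} = {i. i < n \<and> (i \<in> h ` p) \<noteq> (i \<in> h ` p')}"
      by (rule Collect_cong) (metis nth_v length_v)
    also have "\<dots> = sym_diff (h ` p) (h ` p')" by (rule set[OF hs])
    also have "\<dots> = h ` sym_diff p p'"
      using inj PG[OF that(1)] PG[OF that(2)]
      by (simp only: image_Un inj_on_image_set_diff[OF inj] Diff_subset[THEN subset_trans])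
    finally have "hamming (v p) (v p') = card (h ` sym_diff p p')" by (simp only: hamming_def)
    also have "\<dots> = card (sym_diff p p')"
      by (rule card_image, rule inj_on_subset[OF inj]) (use PG that in blast)
    finally show ?thesis by (simp add: sdist_def)
  qed
  have fP: "finite p" if "p \<in> ?P" for p using PG[OF that] fG finite_subset by blast
  have "inj_on v ?P"
  proof (rule inj_onI)
    fix p p' assume "p \<in> ?P" "p' \<in> ?P" "v p = v p'"
    moreover have "hamming x x = 0" for x by (simp add: hamming_def)
    ultimately have "sdist p p' = 0" using d by metis
    thus "p = p'" using fP \<open>p \<in> ?P\<close> \<open>p' \<in> ?P\<close> by (simp add: sdist_eq_0_iff)
  qed
  hence "card (v ` ?P) * n ^ 2 = 2 ^ n" using cP by (simp add: card_image)
  moreover have "dist_at_least (v ` ?P) 6"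
    using code6_bvw_code d by (auto simp: dist_at_least_def code6_def)
  ultimately show ?thesis using vn unfolding n_def by (intro exI[of _ "v ` ?P"]) auto
qed

text \<open>Maximality against the code of \<open>exists_large_code\<close> shows that the Johnson
  bound is attained. As a power of 4, \<open>n\<close> is 1 modulo 3, the residue assumed in the
  equality analysis.\<close>

lemma preparata_codeD:
  assumes "preparata_code n P"
  shows "P \<subseteq> bin_vectors n" "finite P" "min_dist P = 6" "dist_at_least P 6"
    and "\<exists>l>0. n = 3 * l + 1" "2 ^ n \<le> card P * n ^ 2"
proof -
  obtain m where m: "even m" "4 \<le> m" "n = 2 ^ m"
    and P: "P \<subseteq> bin_vectors n" "min_dist P = 6"
    and max: "\<And>D. D \<subseteq> bin_vectors n \<Longrightarrow> dist_at_least D 6 \<Longrightarrow> card D \<le> card P"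
    using assms by (auto simp: preparata_code_def)
  show "P \<subseteq> bin_vectors n" "min_dist P = 6" by fact+
  show fP: "finite P" using P(1) finite_bin_vectors finite_subset by blast
  obtain D where "D \<subseteq> bin_vectors n" "dist_at_least D 6" "card D * n ^ 2 = 2 ^ n"
    using exists_large_code[OF m(1,2)] m(3) by blast
  thus large: "2 ^ n \<le> card P * n ^ 2" using max by (metis mult_le_mono1)
  obtain j where j: "m = 2 * j" using m(1) by blast
  have "\<exists>l. 4 ^ j = 3 * l + (1::nat)"
  proof (induction j)
    case (Suc j)
    then obtain l where "4 ^ j = 3 * l + (1::nat)" by blast
    hence "4 ^ Suc j = 3 * (4 * l + 1) + (1::nat)" by simp
    thus ?case by blast
  qed simp
  then obtain l where l: "n = 3 * l + 1" using m(3) j by (auto simp: power_mult)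
  have n16: "n \<ge> 16" using power_increasing[OF m(2), of "2::nat"] m(3) by simp
  thus "\<exists>l>0. n = 3 * l + 1" using l by (intro exI[of _ l]) auto
  show "dist_at_least P 6"
    unfolding dist_at_least_def
  proof (intro ballI impI)
    fix x y assume xy: "x \<in> P" "y \<in> P" "x \<noteq> y"
    \<comment> \<open>Only for a finite set of distances is \<open>Min\<close> known to be a lower
      bound.\<close>
    have "finite ((\<lambda>(x, y). hamming x y) ` (P \<times> P))" using fP by simp
    hence "finite {hamming x y | x y. x \<in> P \<and> y \<in> P \<and> x \<noteq> y}"
      by (rule finite_subset[rotated]) auto
    hence "Min {hamming x y | x y. x \<in> P \<and> y \<in> P \<and> x \<noteq> y} \<le> hamming x y"
      by (rule Min_le) (use xy in blast)
    thus "6 \<le> hamming x y" using P(2) by (simp add: min_dist_def)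
  qed
qed

lemma support_code:
  assumes "preparata_code n P"
  shows "support ` P \<subseteq> Pow {..<n}" "code6 (support ` P)"
    "2 ^ card {..<n} \<le> card (support ` P) * card {..<n} ^ 2"
proof -
  note D = preparata_codeD[OF assms]
  have "inj_on support P" using inj_on_support D(1) inj_on_subset by blast
  thus "2 ^ card {..<n} \<le> card (support ` P) * card {..<n} ^ 2"
    using D(6) by (simp add: card_image)
  show "support ` P \<subseteq> Pow {..<n}" using support_subset D(1) by blast
  show "code6 (support ` P)"
    using D(1,4) hamming_eq_sdist by (fastforce simp: code6_def dist_at_least_def)
qed

theorem theorem3:
  assumes "preparata_code n P1" and "preparata_code n P2"
  shows "md_graphs_isomorphic P1 P2 \<longleftrightarrow> isometric P1 P2"
proof
  note D1 = preparata_codeD[OF assms(1)] and D2 = preparata_codeD[OF assms(2)]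
  have h1: "hamming x y = sdist (support x) (support y)" if "x \<in> P1" "y \<in> P1" for x y
    using that D1(1) hamming_eq_sdist by blast
  have h2: "hamming x y = sdist (support x) (support y)" if "x \<in> P2" "y \<in> P2" for x y
    using that D2(1) hamming_eq_sdist by blast
  {
    assume "md_graphs_isomorphic P1 P2"
    then obtain f where f: "bij_betw f P1 P2"
      and adj: "\<And>x y. x \<in> P1 \<Longrightarrow> y \<in> P1 \<Longrightarrow> md_adj P1 x y \<longleftrightarrow> md_adj P2 (f x) (f y)"
      by (auto simp: md_graphs_isomorphic_def)
    have fP: "f x \<in> P2" if "x \<in> P1" for x using f that by (auto simp: bij_betw_def)
    have adj6: "hamming x y = 6 \<longleftrightarrow> hamming (f x) (f y) = 6" if "x \<in> P1" "y \<in> P1" for x y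
      using adj[OF that] that fP D1(3) D2(3) by (simp add: md_adj_def)
    obtain l where l: "card {..<n} = 3 * l + 1" "l > 0" using D1(5) by auto
    have inj1: "inj_on support P1" using inj_on_support D1(1) inj_on_subset by blast
    have inj2: "inj_on support P2" using inj_on_support D2(1) inj_on_subset by blast
    \<comment> \<open>The isomorphism is carried over to supports, with \<open>u\<close> recovering
      a codeword from its support.\<close>
    define u where "u = inv_into P1 support"
    have u: "u (support x) = x" if "x \<in> P1" for x using inj1 that by (simp add: u_def)
    define F where "F s = support (f (u s))" for s
    have F: "F (support x) = support (f x)" if "x \<in> P1" for x using u[OF that] by (simp add: F_def)
    have "bij_betw u (support ` P1) P1"
      unfolding u_def using inj1 by (intro bij_betw_inv_into) (simp add: bij_betw_def)
    moreover have "bij_betw support P2 (support ` P2)" using inj2 by (simp add: bij_betw_def)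
    ultimately have bF: "bij_betw F (support ` P1) (support ` P2)"
      using f bij_betw_trans[of u _ _ "support \<circ> f"] bij_betw_trans[of f P1 P2 support]
      by (fastforce simp: F_def[abs_def] o_def)
    have "hamming (f x) (f y) = hamming x y" if xy: "x \<in> P1" "y \<in> P1" for x y
    proof -
      have "sdist (F (support x)) (F (support y)) = sdist (support x) (support y)"
      proof (rule min_distance_preserving_imp_isometry[OF finite_lessThan l support_code(1,2)[OF assms(1)]
            support_code(1,2)[OF assms(2)] support_code(3)[OF assms(1)] support_code(3)[OF assms(2)] bF])
        show "sdist s t = 6 \<longleftrightarrow> sdist (F s) (F t) = 6" if "s \<in> support ` P1" "t \<in> support ` P1" for s t
          using that adj6 h1 h2 fP F by auto
      qed (use xy in auto)
      thus ?thesis using xy F h1 h2 fP by simp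
    qed
    thus "isometric P1 P2" unfolding isometric_def using fP by (intro exI[of _ f]) auto
  next
    assume "isometric P1 P2"
    then obtain I where I: "I ` P1 \<subseteq> P2"
      "\<And>x y. x \<in> P1 \<Longrightarrow> y \<in> P1 \<Longrightarrow> hamming (I x) (I y) = hamming x y"
      by (auto simp: isometric_def)
    have h0: "hamming x x = 0" for x by (simp add: hamming_def)
    have "inj_on I P1"
    proof (rule inj_onI, rule ccontr)
      fix x y assume xy: "x \<in> P1" "y \<in> P1" "I x = I y" "x \<noteq> y"
      hence "hamming x y = 0" using I(2)[of x y] h0 by simp
      moreover have "6 \<le> hamming x y" using D1(4) xy by (simp add: dist_at_least_def)
      ultimately show False by simp
    qed
    \<comment> \<open>Maximality of \<open>P1\<close> against \<open>P2\<close> makes the injective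
      map \<open>I\<close> surjective.\<close>
    moreover have "card P2 \<le> card P1"
      using assms(1) D2(1,4) by (simp add: preparata_code_def)
    ultimately have "I ` P1 = P2" using I(1) D2(2) by (intro card_seteq) (simp_all add: card_image)
    hence "bij_betw I P1 P2" using \<open>inj_on I P1\<close> by (simp add: bij_betw_def)
    moreover have "md_adj P1 x y \<longleftrightarrow> md_adj P2 (I x) (I y)" if "x \<in> P1" "y \<in> P1" for x y
      using that I D1(3) D2(3) by (auto simp: md_adj_def)
    ultimately show "md_graphs_isomorphic P1 P2" unfolding md_graphs_isomorphic_def by blast
  }
qed

end
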